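(* Let $G$ be a bridgeless cubic graph and let $t$ be a positive integer. Then there exist $t$ perfect matchings $M_1,\ldots,M_t$ of $G$ such that no $(2t+1)$-cut $C$ of $G$ satisfies $C\subseteq \bigcap_{i=1}^t M_i$.
   Context: All graphs are finite, simple (no loops, no parallel edges) and connected. A graph is cubic if every vertex has degree 3, and bridgeless if the removal of any single edge leaves it connected. $E(G)$ is the edge-set of $G$. A perfect matching of $G$ is a $1$-regular spanning subgraph of $G$, identified with its set of edges. The perfect matchings $M_1,\ldots,M_t$ are not required to be distinct. A minimal cut in $G$ is a subset $C\subseteq E(G)$ such that $G\setminus C$ (the graph obtained by deleting the edges of $C$) has more connected components than $G$, and $C$ is inclusion-wise minimal with this property. A $k$-cut is a minimal cut of cardinality $k$. *)

theory Defs
  imports Main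
begin

text \<open>
  A graph is given by a vertex set \<open>V\<close> and a set \<open>E\<close> of undirected edges, each edge being the
  two-element set of its ends; hence there are no loops and no parallel edges.
\<close>

locale fin_simple_graph =
  fixes V :: "'a set" and E :: "'a set set"
  assumes finite_verts: "finite V"
    and edge_ends: "e \<in> E \<Longrightarrow> e \<subseteq> V \<and> card e = 2"

definition adjacency :: "'a set set \<Rightarrow> ('a \<times> 'a) set" where
  "adjacency E = {(u, v). {u, v} \<in> E}"

definition graph_components :: "'a set \<Rightarrow> 'a set set \<Rightarrow> 'a set set" where
  "graph_components V E = V // ((adjacency E)\<^sup>* \<inter> V \<times> V)"

definition graph_connected :: "'a set \<Rightarrow> 'a set set \<Rightarrow> bool" where
  "graph_connected V E \<longleftrightarrow> V \<noteq> {} \<and> (\<forall>u\<in>V. \<forall>v\<in>V. (u, v) \<in> (adjacency E)\<^sup>*)"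

definition vertex_degree :: "'a set set \<Rightarrow> 'a \<Rightarrow> nat" where
  "vertex_degree E v = card {e \<in> E. v \<in> e}"

definition regular_graph :: "nat \<Rightarrow> 'a set \<Rightarrow> 'a set set \<Rightarrow> bool" where
  "regular_graph k V E \<longleftrightarrow> (\<forall>v\<in>V. vertex_degree E v = k)"

definition cubic_graph :: "'a set \<Rightarrow> 'a set set \<Rightarrow> bool" where
  "cubic_graph V E \<longleftrightarrow> regular_graph 3 V E"

definition bridgeless_graph :: "'a set \<Rightarrow> 'a set set \<Rightarrow> bool" where
  "bridgeless_graph V E \<longleftrightarrow> (\<forall>e\<in>E. graph_connected V (E - {e}))"

definition perfect_matching :: "'a set \<Rightarrow> 'a set set \<Rightarrow> 'a set set \<Rightarrow> bool" where
  "perfect_matching V E M \<longleftrightarrow> M \<subseteq> E \<and> regular_graph 1 V M"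

definition edge_cut :: "'a set \<Rightarrow> 'a set set \<Rightarrow> 'a set set \<Rightarrow> bool" where
  "edge_cut V E C \<longleftrightarrow>
     C \<subseteq> E \<and> card (graph_components V (E - C)) > card (graph_components V E)"

definition minimal_edge_cut :: "'a set \<Rightarrow> 'a set set \<Rightarrow> 'a set set \<Rightarrow> bool" where
  "minimal_edge_cut V E C \<longleftrightarrow> edge_cut V E C \<and> (\<forall>D. D \<subset> C \<longrightarrow> \<not> edge_cut V E D)"

definition k_edge_cut :: "nat \<Rightarrow> 'a set \<Rightarrow> 'a set set \<Rightarrow> 'a set set \<Rightarrow> bool" where
  "k_edge_cut k V E C \<longleftrightarrow> minimal_edge_cut V E C \<and> card C = k"

end

theory Submission
  imports Defs
begin

text \<open>
  Write \<open>\<delta>(A)\<close> for the set of edges with exactly one end in \<open>A\<close>. The matchings are chosen one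
  after the other. Let \<open>x\<close> be the weight that gives an edge \<open>t + 1\<close> minus the number of those of
  \<open>M\<^sub>1, \<dots>, M\<^sub>t\<close> that contain it. The weights at each vertex sum to
  \<open>3 (t + 1) - t = 2 t + 3\<close>. The choice maintains the bound \<open>x(\<delta>(A)) \<ge> 2 t + 3\<close> for every vertex
  set \<open>A\<close> of odd size: in Seymour's terms, \<open>x\<close> is an \<open>r\<close>-graph with \<open>r = 2 t + 3\<close>, edges being
  repeated according to their weight. This bound is what the theorem needs. A minimal cut has the
  form \<open>\<delta>(A)\<close>, and \<open>A\<close> is odd if the cut has \<open>2 t + 1\<close> edges, because the graph is cubic. If such
  a cut lay in every \<open>M\<^sub>i\<close>, each of its edges would have weight \<open>(t + 1) - t = 1\<close>, and its total
  weight \<open>2 t + 1\<close> would be too small.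
  
  For \<open>t = 0\<close> the bound says that an odd cut of a bridgeless cubic graph has at least three edges;
  by parity it has an odd number of them, and a single one would be a bridge. To go from \<open>r\<close> to
  \<open>r + 2\<close> (lemma \<open>r_graph_add_remove_matching\<close>), every edge gains weight 1 and the edges of the
  new matching \<open>M\<close> lose it again. If \<open>x(\<delta>(A)) > r\<close>, then \<open>x(\<delta>(A)) \<ge> r + 2\<close> by parity, and
  the cut loses nothing because \<open>M \<inter> \<delta>(A) \<subseteq> \<delta>(A)\<close>. If \<open>x(\<delta>(A)) = r\<close>, the cut is called tight,
  and it gains at least \<open>3 - 1\<close> as soon as \<open>M\<close> contains exactly one of its edges. So everything
  rests on the following fact (\<open>r_graph_matching_through_edge\<close>): an \<open>r\<close>-graph has a perfect
  matching that meets every tight odd cut exactly once.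
  
  That fact is usually read off from Edmonds' description of the perfect matching polytope, as
  \<open>x / r\<close> is a convex combination of perfect matchings. The proof below is combinatorial instead.
  It is an induction on the number of vertices, for the stronger claim that the matching can be
  made to contain a prescribed edge. If some tight cut \<open>\<delta>(S)\<close> has at least two vertices on either
  side, both graphs obtained by contracting one of its sides are smaller \<open>r\<close>-graphs; matchings of
  them that use the same edge of \<open>\<delta>(S)\<close> are glued, and tight cuts that cross \<open>\<delta>(S)\<close> are treated by
  uncrossing. If there is no such \<open>S\<close>, the tight odd cuts are those around single vertices, which
  all perfect matchings meet exactly once, and it remains to find a perfect matching through the
  given edge. Tutte's theorem yields one, its hypothesis being a count of edge weights.
\<close>

section \<open>Tutte's theorem\<close>

text \<open>
  A perfect matching on \<open>W\<close> as the map that sends each vertex to its partner. Alternating paths are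
  then orbits of the composition of two such maps.
\<close>

definition pairing :: "'a set \<Rightarrow> ('a \<Rightarrow> 'a \<Rightarrow> bool) \<Rightarrow> ('a \<Rightarrow> 'a) \<Rightarrow> bool" where
  "pairing W G f \<longleftrightarrow> (\<forall>v\<in>W. f v \<in> W \<and> f (f v) = v \<and> G v (f v))"

lemma pairing_empty: "pairing {} G f"
  by (simp add: pairing_def)

lemma pairing_Un:
  assumes "pairing A G f" "pairing B G g" "A \<inter> B = {}"
  shows "pairing (A \<union> B) G (\<lambda>v. if v \<in> A then f v else g v)"
  using assms unfolding pairing_def by (auto split: if_splits)

lemma pairing_doubleton:
  assumes "G a b" "G b a"
  shows "pairing {a, b} G (\<lambda>v. if v = a then b else a)"
  using assms by (auto simp: pairing_def)

lemma pairing_mono: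
  assumes "pairing W G f" "\<And>v. v \<in> W \<Longrightarrow> G v (f v) \<Longrightarrow> H v (f v)"
  shows "pairing W H f"
  using assms by (auto simp: pairing_def)

lemma pairing_even:
  assumes "finite W" "pairing W G f" "\<And>v. \<not> G v v"
  shows "even (card W)"
  using assms(1,2)
proof (induction W rule: finite_psubset_induct)
  case (psubset W)
  show ?case
  proof (cases "W = {}")
    case False
    then obtain v where v: "v \<in> W" by blast
    let ?W = "W - {v, f v}"
    have fv: "f v \<in> W" "f (f v) = v" "f v \<noteq> v"
      using v psubset.prems assms(3) unfolding pairing_def by metis+
    have "pairing ?W G f"
      using psubset.prems fv v unfolding pairing_def by (metis Diff_iff insert_iff empty_iff)
    then have "even (card ?W)"
      using psubset.IH[of ?W] v by blast
    moreover have "card W = card ?W + 2"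
    proof -
      have "card {v, f v} = 2" using fv by simp
      then show ?thesis
        using card_Diff_subset[of "{v, f v}" W] card_mono[of W "{v, f v}"] v fv psubset.hyps
        by auto
    qed
    ultimately show ?thesis by simp
  qed simp
qed

text \<open>
  The core of Lovasz's proof of Tutte's theorem. The pairing \<open>f\<close> uses edges of \<open>H\<close> except for the
  pair \<open>a c\<close>, and \<open>g\<close> uses edges of \<open>H\<close> except for the pair \<open>b d\<close>, while \<open>b\<close> is joined to both
  \<open>a\<close> and \<open>c\<close>. Walk from \<open>d\<close> along the cycle formed by \<open>f\<close>-pairs and \<open>g\<close>-pairs alternately; its
  last vertex is \<open>b\<close>. If the cycle avoids \<open>a\<close> and \<open>c\<close>, take \<open>f\<close> on the cycle and \<open>g\<close> off it.
  Otherwise stop at the first of \<open>a\<close> and \<open>c\<close>, pair this vertex with \<open>b\<close>, take \<open>f\<close> on the part of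
  the cycle that has been passed, and \<open>g\<close> everywhere else.
\<close>

lemma alternating_exchange:
  assumes W: "finite W" "a \<in> W" "b \<in> W" "c \<in> W" "d \<in> W"
    and f: "\<And>v. v \<in> W \<Longrightarrow> f v \<in> W \<and> f (f v) = v \<and> f v \<noteq> v" "f a = c"
    and g: "\<And>v. v \<in> W \<Longrightarrow> g v \<in> W \<and> g (g v) = v \<and> g v \<noteq> v" "g b = d"
    and Hf: "\<And>v. v \<in> W \<Longrightarrow> v \<noteq> a \<Longrightarrow> v \<noteq> c \<Longrightarrow> H v (f v)"
    and Hg: "\<And>v. v \<in> W \<Longrightarrow> v \<noteq> b \<Longrightarrow> v \<noteq> d \<Longrightarrow> H v (g v)"
    and H: "H a b" "H b a" "H c b" "H b c"
    and ne: "b \<noteq> a" "b \<noteq> c" "d \<noteq> a" "d \<noteq> c"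
  shows "\<exists>h. pairing W H h"
proof -
  \<comment> \<open>The walk visits \<open>q 0, f (q 0), q 1, f (q 1), \<dots>\<close>: first an \<open>f\<close>-pair, then a \<open>g\<close>-pair.\<close>
  define q where "q j = ((g \<circ> f) ^^ j) d" for j
  have q0: "q 0 = d" and qS: "q (Suc j) = g (f (q j))" for j
    by (simp_all add: q_def)
  have qW: "q j \<in> W" for j
    by (induction j) (use W f g in \<open>auto simp: q0 qS\<close>)
  have fq: "f (f (q j)) = q j" "f (q j) \<in> W" for j
    using f(1) qW by blast+
  have gqS: "g (q (Suc j)) = f (q j)" for j
    using g(1) fq(2) by (simp add: qS)
  have gq0: "g (q 0) = b" using g W q0 by metis
  have q_back: "q j = f (g (q (Suc j)))" for j
    by (simp add: gqS fq)
  \<comment> \<open>By finiteness the walk returns to \<open>d\<close>, and the vertex before the return is \<open>g d = b\<close>.\<close>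
  have "\<not> inj_on q {..card W}"
  proof
    assume "inj_on q {..card W}"
    then have "card (q ` {..card W}) = Suc (card W)" by (simp add: card_image)
    moreover have "card (q ` {..card W}) \<le> card W"
      using qW W(1) by (intro card_mono) auto
    ultimately show False by simp
  qed
  then obtain i0 k where "q i0 = q (i0 + Suc k)"
    unfolding inj_on_def
    by (metis less_iff_Suc_add linorder_neqE_nat add_Suc_right)
  then have "q 0 = q (Suc k)"
  proof (induction i0)
    case (Suc i)
    then show ?case using q_back[of i] q_back[of "i + Suc k"] by simp
  qed simp
  then have "f (q k) = b" using gqS[of k] gq0 by simp
  then have "\<exists>i. q i \<in> {a, c} \<or> f (q i) = b" by blast
  then obtain i where i: "q i \<in> {a, c} \<or> f (q i) = b"
    and least: "\<And>j. j < i \<Longrightarrow> \<not> (q j \<in> {a, c} \<or> f (q j) = b)"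
    using exists_least_iff[of "\<lambda>i. q i \<in> {a, c} \<or> f (q i) = b"] by blast
  have fc: "f c = a" using f W by metis
  have f_ac: "f (q j) \<notin> {a, c}" if "q j \<notin> {a, c}" for j
    using that fq(1)[of j] f(2) fc by auto
  \<comment> \<open>The vertices \<open>q j\<close> and \<open>f (q j)\<close> lie at even and odd positions of the cycle and are never equal:
    an equality could be moved inwards from both ends until \<open>f\<close> or \<open>g\<close> had a fixed point.\<close>
  have even_odd: "f (q m) \<noteq> q (m + n)" for m n
  proof (induction n arbitrary: m rule: less_induct)
    case (less n)
    consider "n = 0" | "n = 1" | n' where "n = Suc (Suc n')"
      by (metis One_nat_def not0_implies_Suc)
    then show ?case
    proof cases
      case 1
      then show ?thesis using f(1) qW by simp
    next
      case 2
      then show ?thesis using g(1) fq(2) by (simp add: qS) metis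
    next
      case 3
      have "f (q (Suc m)) \<noteq> q (Suc m + n')" using less.IH[of n' "Suc m"] 3 by simp
      then show ?thesis
        using 3 gqS[of "m + Suc n'"] qS[of m] fq(1) by (metis add_Suc_right add_Suc_shift)
    qed
  qed
  have disj: "f (q m) \<noteq> q n" for m n
  proof (cases "m \<le> n")
    case True
    then show ?thesis using even_odd[of m "n - m"] by simp
  next
    case False
    then show ?thesis using even_odd[of n "m - n"] fq(1)[of m] by (metis le_add_diff_inverse nat_le_linear)
  qed
  have q_b: "q j \<noteq> b" for j
  proof (cases j)
    case 0
    then show ?thesis using gq0 g(1) qW by metis
  next
    case (Suc j')
    show ?thesis
    proof
      assume "q j = b"
      then have "f (q j') = q 0" using Suc gqS g(2) q0 by metis
      then show False using disj by blast
    qed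
  qed
  show ?thesis
  proof (cases "q i \<in> {a, c}")
    case True
    define Q where "Q = (\<Union>j<i. {q j, f (q j)})"
    define h where "h v = (if v \<in> Q then f v else if v = q i then b else if v = b then q i else g v)" for v
    have i_pos: "0 < i" using True q0 ne by (cases i) auto
    have Q_ac: "a \<notin> Q" "c \<notin> Q" using least f_ac unfolding Q_def by fastforce+
    have b_Q: "b \<notin> Q" using least q_b unfolding Q_def by fastforce
    have fQ: "f v \<in> Q" if "v \<in> Q" for v
      using that fq(1) unfolding Q_def by auto
    have dQ: "d \<in> Q" using i_pos q0 unfolding Q_def by force
    have gR: "g v \<in> Q \<union> {q i, b}" if "v \<in> Q \<union> {q i, b}" for v
    proof -
      have 1: "g (q j) \<in> Q \<union> {q i, b}" if "j \<le> i" for j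
        using that gq0 gqS by (cases j) (auto simp: Q_def)
      have 2: "g (f (q j)) \<in> Q \<union> {q i, b}" if "j < i" for j
        using that qS[of j] by (cases "Suc j = i") (auto simp: Q_def intro!: bexI[of _ "Suc j"])
      from that consider j where "j < i" "v = q j" | j where "j < i" "v = f (q j)" | "v = q i" | "v = b"
        unfolding Q_def by blast
      then show ?thesis by cases (use 1 2 g(2) dQ in auto)
    qed
    have "pairing W H h"
      unfolding pairing_def
    proof (intro ballI)
      fix v assume v: "v \<in> W"
      consider "v \<in> Q" | "v = q i" | "v = b" | "v \<notin> Q \<union> {q i, b}" by blast
      then show "h v \<in> W \<and> h (h v) = v \<and> H v (h v)"
      proof cases
        case 1
        then have "v \<noteq> a" "v \<noteq> c" using Q_ac by auto
        then show ?thesis using 1 fQ f(1) v Hf by (simp add: h_def)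
      next
        case 2
        then show ?thesis using True Q_ac b_Q W H q_b by (auto simp: h_def)
      next
        case 3
        then show ?thesis using True Q_ac b_Q W H q_b by (auto simp: h_def)
      next
        case 4
        have "g v \<notin> Q \<union> {q i, b}" using 4 gR[of "g v"] g(1) v by auto
        moreover have "v \<noteq> d" using 4 dQ by blast
        ultimately show ?thesis using 4 g(1) v Hg by (simp add: h_def)
      qed
    qed
    then show ?thesis by blast
  next
    case False
    define Q where "Q = (\<Union>j\<le>i. {q j, f (q j)})"
    have i': "f (q i) = b" using i False by blast
    have not_ac: "q j \<notin> {a, c}" if "j \<le> i" for j
      using that least False by (cases "j = i") auto
    have QW: "Q \<subseteq> W" using qW fq by (auto simp: Q_def)
    have Q_ac: "a \<notin> Q" "c \<notin> Q" using not_ac f_ac unfolding Q_def by fastforce+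
    have fQ: "f v \<in> Q" if "v \<in> Q" for v
      using that fq(1) unfolding Q_def by auto
    have bQ: "b \<in> Q" using i' unfolding Q_def by force
    have dQ: "d \<in> Q" using q0 unfolding Q_def by force
    have gQ: "g v \<in> Q" if "v \<in> Q" for v
    proof -
      have 1: "g (q j) \<in> Q" if "j \<le> i" for j
        using that gq0 gqS bQ by (cases j) (auto simp: Q_def)
      have 2: "g (f (q j)) \<in> Q" if "j \<le> i" for j
        using that qS[of j] i' g(2) dQ
        by (cases "j = i") (auto simp: Q_def intro!: bexI[of _ "Suc j"])
      show ?thesis using that 1 2 unfolding Q_def by auto
    qed
    have "pairing Q H f"
      unfolding pairing_def using fQ f(1) QW Hf Q_ac by blast
    moreover have "pairing (W - Q) H g"
      unfolding pairing_def
    proof (intro ballI)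
      fix v assume v: "v \<in> W - Q"
      then have "g v \<notin> Q" using gQ[of "g v"] g(1) by auto
      then show "g v \<in> W - Q \<and> g (g v) = v \<and> H v (g v)"
        using v g(1) Hg bQ dQ by blast
    qed
    ultimately show ?thesis
      using pairing_Un[of Q H f "W - Q" g] QW by (metis Diff_disjoint Un_Diff_cancel Un_absorb1)
  qed
qed

text \<open>
  Pair off two vertices at a time: one of \<open>A\<close> with one of \<open>B\<close> as long as \<open>A\<close> is nonempty, then
  two of \<open>B\<close>.
\<close>

lemma pairing_into_universal:
  assumes "finite A" "finite B" "A \<inter> B = {}" "card A \<le> card B" "even (card A + card B)"
    and sym: "\<And>u v. G u v \<Longrightarrow> G v u"
    and univ: "\<And>b v. b \<in> B \<Longrightarrow> v \<in> A \<union> B \<Longrightarrow> v \<noteq> b \<Longrightarrow> G b v"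
  shows "\<exists>f. pairing (A \<union> B) G f"
  using assms(1-5,7)
proof (induction "card A + card B" arbitrary: A B rule: less_induct)
  case less
  show ?case
  proof (cases "B = {}")
    case True
    then have "A = {}" using less.prems by simp
    then show ?thesis using True by (auto simp: pairing_def)
  next
    case False
    then obtain b where b: "b \<in> B" by blast
    obtain v where v: "v \<in> A \<union> (B - {b})" "A \<noteq> {} \<longrightarrow> v \<in> A"
    proof (cases "A = {}")
      case True
      then have "B \<noteq> {b}" using less.prems by auto
      then show ?thesis using that True b by blast
    qed (use that in blast)
    let ?A = "A - {v}" and ?B = "B - {b} - {v}"
    have bv: "b \<noteq> v" using v b less.prems by auto
    have "\<exists>f. pairing (?A \<union> ?B) G f"
    proof (cases "A = {}")
      case True
      then have vB: "v \<in> B - {b}" using v by blast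
      have cB: "card ?B + 2 = card B"
        using vB b less.prems by (metis add_2_eq_Suc' card_Suc_Diff1 finite_Diff)
      show ?thesis
      proof (rule less.hyps)
        show "even (card ?A + card ?B)" using True less.prems cB by (auto simp flip: cB)
      qed (use True cB less.prems in auto)
    next
      case False
      then have vA: "v \<in> A" using v by blast
      have cA: "Suc (card ?A) = card A" using vA less.prems by (simp only: card_Suc_Diff1)
      have eqB: "?B = B - {b}" using vA less.prems by blast
      have cB: "Suc (card ?B) = card B" unfolding eqB using b less.prems by (simp only: card_Suc_Diff1)
      show ?thesis
      proof (rule less.hyps)
        show "even (card ?A + card ?B)" using less.prems(5) by (simp flip: cA cB)
        show "card ?A \<le> card ?B" using less.prems(4) by (simp flip: cA cB)
        show "card ?A + card ?B < card A + card B" by (simp flip: cA cB)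
      qed (use less.prems in auto)
    qed
    then obtain f where f: "pairing (?A \<union> ?B) G f" by blast
    have "G b v" using less.prems(6) b v bv by auto
    then have "pairing {b, v} G (\<lambda>w. if w = b then v else b)"
      using pairing_doubleton sym by metis
    moreover have "(?A \<union> ?B) \<inter> {b, v} = {}" using b less.prems(3) by auto
    ultimately have "\<exists>h. pairing (?A \<union> ?B \<union> {b, v}) G h"
      using pairing_Un[OF f] by blast
    moreover have "?A \<union> ?B \<union> {b, v} = A \<union> B" using b v by auto
    ultimately show ?thesis by metis
  qed
qed

text \<open>
  A stand-in for the odd components of the graph induced on \<open>X\<close>. Each member is a union of
  components, one of which is odd, so the number of odd components is the maximal size of such a
  family. Working with arbitrary families makes the bound in Tutte's theorem pass to graphs with
  more edges at once, without following what happens to the components.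
\<close>

definition isolated_odd_family :: "'a set \<Rightarrow> ('a \<Rightarrow> 'a \<Rightarrow> bool) \<Rightarrow> 'a set set \<Rightarrow> bool" where
  "isolated_odd_family X G F \<longleftrightarrow>
     (\<forall>A\<in>F. A \<subseteq> X \<and> odd (card A) \<and> (\<forall>a\<in>A. \<forall>b\<in>X - A. \<not> G a b)) \<and>
     (\<forall>A\<in>F. \<forall>B\<in>F. A \<noteq> B \<longrightarrow> A \<inter> B = {})"

lemma isolated_odd_family_mono:
  assumes "isolated_odd_family X H F" "\<And>u v. G u v \<Longrightarrow> H u v"
  shows "isolated_odd_family X G F"
proof -
  have "\<not> G a b" if "A \<in> F" "a \<in> A" "b \<in> X - A" for A a b
  proof -
    have "\<not> H a b" using assms(1) that unfolding isolated_odd_family_def by metis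
    then show ?thesis using assms(2)[of a b] by metis
  qed
  then show ?thesis using assms(1) by (simp add: isolated_odd_family_def)
qed

text \<open>
  The extremal case of Tutte's theorem: \<open>U\<close> consists of vertices adjacent to all others, and the
  rest is a disjoint union of cliques. A maximal matching of the rest leaves at most one vertex in
  each clique, and exactly the odd cliques keep one. By the bound \<open>U\<close> is large enough to absorb
  these vertices, and what remains of \<open>U\<close> is complete and even.
\<close>

lemma pairing_of_cliques:
  assumes W: "finite W" "even (card W)" "U \<subseteq> W"
    and sym: "\<And>u v. G u v \<Longrightarrow> G v u" and irr: "\<And>v. \<not> G v v"
    and univ: "\<And>u v. u \<in> U \<Longrightarrow> v \<in> W \<Longrightarrow> v \<noteq> u \<Longrightarrow> G u v"
    and trans: "\<And>a b c. a \<in> W - U \<Longrightarrow> b \<in> W - U \<Longrightarrow> c \<in> W - U \<Longrightarrow> G a b \<Longrightarrow> G b c \<Longrightarrow> a \<noteq> c \<Longrightarrow> G a c"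
    and bound: "\<And>F. isolated_odd_family (W - U) G F \<Longrightarrow> card F \<le> card U"
  shows "\<exists>f. pairing W G f"
proof -
  let ?X = "W - U"
  let ?P = "\<lambda>L. L \<subseteq> ?X \<and> (\<exists>f. pairing (?X - L) G f)"
  have "?P ?X" by (simp add: pairing_empty)
  then obtain L where L: "L \<subseteq> ?X" "\<exists>f. pairing (?X - L) G f"
    and L_min: "\<And>L'. ?P L' \<Longrightarrow> card L \<le> card L'"
    using ex_has_least_nat[of ?P ?X card] by blast
  then obtain f where f: "pairing (?X - L) G f" by blast
  have finX: "finite ?X" and finL: "finite L" using W(1) L(1) by (auto intro: finite_subset[of L "W - U"])
  have indep: "\<not> G l m" if "l \<in> L" "m \<in> L" for l m
  proof
    assume lm: "G l m"
    then have "pairing {l, m} G (\<lambda>v. if v = l then m else l)"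
      using pairing_doubleton sym by metis
    moreover have "(?X - L) \<inter> {l, m} = {}" using that by auto
    ultimately have "\<exists>h. pairing ((?X - L) \<union> {l, m}) G h"
      using pairing_Un[OF f] by blast
    moreover have "(?X - L) \<union> {l, m} = ?X - (L - {l, m})" using that L by auto
    ultimately have "card L \<le> card (L - {l, m})"
      using L_min[of "L - {l, m}"] L by auto
    moreover have "card (L - {l, m}) < card L"
      using that finL by (intro psubset_card_mono) auto
    ultimately show False by simp
  qed
  \<comment> \<open>The clique of \<open>l\<close>. The matching \<open>f\<close> pairs off all of it except \<open>l\<close>, so it is odd.\<close>
  define K where "K l = insert l {w \<in> ?X. G l w}" for l
  have K_sub: "K l \<subseteq> ?X" if "l \<in> L" for l using that L by (auto simp: K_def)
  have K_closed: "w \<in> K l" if "l \<in> L" "v \<in> K l" "w \<in> ?X" "G v w" for l v w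
    using that trans[of l v w] L by (auto simp: K_def)
  have K_odd: "odd (card (K l))" if l: "l \<in> L" for l
  proof -
    have "pairing (K l - {l}) G f"
      unfolding pairing_def
    proof (intro ballI)
      fix v assume v: "v \<in> K l - {l}"
      then have "v \<in> ?X - L" using indep l by (auto simp: K_def)
      then have fv: "f v \<in> ?X - L" "f (f v) = v" "G v (f v)" using f by (auto simp: pairing_def)
      then show "f v \<in> K l - {l} \<and> f (f v) = v \<and> G v (f v)"
        using K_closed[OF l, of v "f v"] v l by auto
    qed
    then have "even (card (K l - {l}))"
      using pairing_even irr finX K_sub[OF l] by (meson finite_Diff finite_subset)
    moreover have "card (K l) = Suc (card (K l - {l}))"
      using finX K_sub[OF l] finite_subset by (metis K_def card.remove insertI1)
    ultimately show ?thesis by simp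
  qed
  have K_disj: "l = m" if "l \<in> L" "m \<in> L" "v \<in> K l" "v \<in> K m" for l m v
  proof -
    have "m \<in> K l"
    proof (cases "v = m")
      case False
      then have "G v m" using that(4) sym by (auto simp: K_def)
      then show ?thesis using K_closed[OF that(1) that(3)] that(2) L by blast
    qed (use that in simp)
    then show ?thesis using indep that by (auto simp: K_def)
  qed
  have "isolated_odd_family ?X G (K ` L)"
    unfolding isolated_odd_family_def using K_sub K_odd K_closed K_disj by blast
  then have "card (K ` L) \<le> card U" by (rule bound)
  moreover have "inj_on K L"
    by (rule inj_onI) (metis K_disj K_def insertI1)
  ultimately have LU: "card L \<le> card U" by (simp add: card_image)
  have finU: "finite U" using W finite_subset by blast
  have "card W = card (?X - L) + (card L + card U)"
  proof -
    have "card W = card ?X + card U" 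
      using W finU by (metis card_Diff_subset card_mono le_add_diff_inverse2)
    moreover have "card ?X = card (?X - L) + card L"
      using L finL finX by (metis card_Diff_subset card_mono le_add_diff_inverse2)
    ultimately show ?thesis by simp
  qed
  moreover have "even (card (?X - L))"
    using pairing_even f irr finX by blast
  ultimately have "even (card L + card U)" using W(2) by simp
  then have "\<exists>g. pairing (L \<union> U) G g"
    using L W finL finU LU sym univ by (intro pairing_into_universal) auto
  then obtain g where "pairing (L \<union> U) G g" by blast
  moreover have "(?X - L) \<inter> (L \<union> U) = {}" by blast
  moreover have "(?X - L) \<union> (L \<union> U) = W" using L W by blast
  ultimately show ?thesis using pairing_Un[OF f] by metis
qed

text \<open>
  Suppose that there is no pairing, and add edges until every further edge would create a pairing. In the resulting
  graph \<open>H\<close> let \<open>U\<close> be the set of the vertices adjacent to all others. If adjacency is transitive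
  off \<open>U\<close>, \<open>H\<close> has the form treated in \<open>pairing_of_cliques\<close>. Otherwise there are adjacent pairs
  \<open>a b\<close> and \<open>b c\<close> and non-adjacent pairs \<open>a c\<close> and \<open>b d\<close>; adding either of the last two creates a
  pairing, and \<open>alternating_exchange\<close> merges these two pairings into one of \<open>H\<close>.
\<close>

theorem Tutte_pairing:
  fixes G :: "'a \<Rightarrow> 'a \<Rightarrow> bool"
  assumes W: "finite W"
    and sym: "\<And>u v. G u v \<Longrightarrow> G v u" and irr: "\<And>v. \<not> G v v"
    and bound: "\<And>U F. U \<subseteq> W \<Longrightarrow> isolated_odd_family (W - U) G F \<Longrightarrow> card F \<le> card U"
  shows "\<exists>f. pairing W G f"
proof (rule ccontr)
  assume none: "\<nexists>f. pairing W G f"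
  have evenW: "even (card W)"
  proof (rule ccontr)
    assume "odd (card W)"
    then have "isolated_odd_family (W - {}) G {W}" by (auto simp: isolated_odd_family_def)
    then show False using bound[of "{}" "{W}"] by simp
  qed
  define gr where "gr R = (\<lambda>u v. G u v \<or> (u, v) \<in> R)" for R :: "('a \<times> 'a) set"
  define S where "S = {R. R \<subseteq> W \<times> W \<and> sym R \<and> irrefl R \<and> (\<nexists>f. pairing W (gr R) f)}"
  have "S \<subseteq> Pow (W \<times> W)" by (auto simp: S_def)
  then have "finite S" using W finite_subset by blast
  moreover have "{} \<in> S" using none by (simp add: S_def gr_def sym_def irrefl_def)
  ultimately obtain R where R: "R \<in> S" and maxR: "\<And>R'. R' \<in> S \<Longrightarrow> R \<subseteq> R' \<Longrightarrow> R = R'"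
    using finite_has_maximal[of S] by blast
  define H where "H = gr R"
  have symH: "H u v \<Longrightarrow> H v u" and irrH: "\<not> H v v" for u v
    using R sym irr by (auto simp: H_def gr_def S_def sym_def irrefl_def)
  have noneH: "\<nexists>f. pairing W H f" using R by (simp add: S_def H_def)
  \<comment> \<open>By maximality a new edge creates a pairing, and that pairing must use the new edge.\<close>
  have add: "\<exists>f. pairing W (\<lambda>u v. H u v \<or> (u, v) \<in> {(a, c), (c, a)}) f \<and> f a = c"
    if ac: "a \<in> W" "c \<in> W" "a \<noteq> c" "\<not> H a c" for a c
  proof -
    let ?R = "R \<union> {(a, c), (c, a)}"
    have "R \<noteq> ?R" using ac by (auto simp: H_def gr_def)
    then have "?R \<notin> S" using maxR by blast
    moreover have "?R \<subseteq> W \<times> W" "sym ?R" "irrefl ?R"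
      using R ac by (auto simp: S_def sym_def irrefl_def)
    ultimately obtain f where "pairing W (gr ?R) f" by (auto simp: S_def)
    then have f: "pairing W (\<lambda>u v. H u v \<or> (u, v) \<in> {(a, c), (c, a)}) f"
      by (auto simp: gr_def H_def pairing_def)
    have "f a = c"
    proof (rule ccontr)
      assume "f a \<noteq> c"
      then have "f c \<noteq> a" using f ac unfolding pairing_def by metis
      then have "pairing W H f" using f \<open>f a \<noteq> c\<close> by (auto simp: pairing_def)
      then show False using noneH by blast
    qed
    then show ?thesis using f by blast
  qed
  define U where "U = {u \<in> W. \<forall>w\<in>W. w \<noteq> u \<longrightarrow> H u w}"
  have "\<exists>a b c. a \<in> W - U \<and> b \<in> W - U \<and> c \<in> W - U \<and> H a b \<and> H b c \<and> a \<noteq> c \<and> \<not> H a c"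
  proof (rule ccontr)
    assume tr: "\<not> ?thesis"
    have "\<exists>f. pairing W H f"
    proof (rule pairing_of_cliques)
      show "card F \<le> card U" if "isolated_odd_family (W - U) H F" for F
        using that isolated_odd_family_mono[of "W - U" H F G] bound[of U F]
        by (auto simp: H_def gr_def U_def)
      show "H a c" if "a \<in> W - U" "b \<in> W - U" "c \<in> W - U" "H a b" "H b c" "a \<noteq> c" for a b c
        using tr that by blast
    qed (use W evenW symH irrH in \<open>auto simp: U_def\<close>)
    then show False using noneH by blast
  qed
  then obtain a b c where abc: "a \<in> W" "b \<in> W - U" "c \<in> W" "H a b" "H b c" "a \<noteq> c" "\<not> H a c"
    by blast
  then obtain d where d: "d \<in> W" "d \<noteq> b" "\<not> H b d" by (auto simp: U_def)
  obtain f where f: "pairing W (\<lambda>u v. H u v \<or> (u, v) \<in> {(a, c), (c, a)}) f" "f a = c"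
    using add[of a c] abc by blast
  obtain g where g: "pairing W (\<lambda>u v. H u v \<or> (u, v) \<in> {(b, d), (d, b)}) g" "g b = d"
    using add[of b d] abc d by blast
  have "\<exists>h. pairing W H h"
  proof (rule alternating_exchange[of W a b c d f g H])
    show "f v \<in> W \<and> f (f v) = v \<and> f v \<noteq> v" if "v \<in> W" for v
      using f(1) that irrH abc(6) unfolding pairing_def by fastforce
    show "g v \<in> W \<and> g (g v) = v \<and> g v \<noteq> v" if "v \<in> W" for v
      using g(1) that irrH d(2) unfolding pairing_def by fastforce
    show "H v (f v)" if "v \<in> W" "v \<noteq> a" "v \<noteq> c" for v
      using f(1) that unfolding pairing_def by auto
    show "H v (g v)" if "v \<in> W" "v \<noteq> b" "v \<noteq> d" for v
      using g(1) that unfolding pairing_def by auto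
  qed (use W abc d f g symH irrH in auto)
  then show False using noneH by blast
qed

section \<open>Edge weights and cuts\<close>

definition between :: "('a \<Rightarrow> 'a \<Rightarrow> nat) \<Rightarrow> 'a set \<Rightarrow> 'a set \<Rightarrow> nat" where
  "between x A B = (\<Sum>a\<in>A. \<Sum>b\<in>B. x a b)"

lemma between_empty [simp]: "between x {} B = 0" "between x A {} = 0"
  by (simp_all add: between_def)

lemma between_commute:
  assumes "\<And>a b. a \<in> A \<Longrightarrow> b \<in> B \<Longrightarrow> x a b = x b a"
  shows "between x A B = between x B A"
proof -
  have "between x A B = (\<Sum>a\<in>A. \<Sum>b\<in>B. x b a)"
    unfolding between_def by (intro sum.cong refl) (use assms in blast)
  then show ?thesis by (simp add: between_def sum.swap[of _ A B])
qed

lemma between_Un_left: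
  assumes "finite A" "finite B" "A \<inter> B = {}"
  shows "between x (A \<union> B) C = between x A C + between x B C"
  using assms by (simp add: between_def sum.union_disjoint)

lemma between_Un_right:
  assumes "finite B" "finite C" "B \<inter> C = {}"
  shows "between x A (B \<union> C) = between x A B + between x A C"
  using assms by (simp add: between_def sum.union_disjoint sum.distrib)

lemma between_split:
  assumes "finite B" "C \<subseteq> B"
  shows "between x A B = between x A C + between x A (B - C)"
proof -
  have "B = C \<union> (B - C)" using assms by blast
  then show ?thesis
    using assms between_Un_right[of C "B - C" x A] by (metis Diff_disjoint finite_Diff finite_subset)
qed

lemma between_mono:
  assumes "finite A'" "finite B'" "A \<subseteq> A'" "B \<subseteq> B'"
  shows "between x A B \<le> between x A' B'"
  unfolding between_def
  by (rule order_trans[OF sum_mono sum_mono2]) (use assms in \<open>auto intro: sum_mono2\<close>)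

lemma between_add: "between (\<lambda>a b. x a b + y a b) A B = between x A B + between y A B"
  by (simp add: between_def sum.distrib)

lemma between_mono_weight:
  assumes "\<And>a b. a \<in> A \<Longrightarrow> b \<in> B \<Longrightarrow> x a b \<le> y a b"
  shows "between x A B \<le> between y A B"
  unfolding between_def by (intro sum_mono assms)

lemma between_cong:
  assumes "\<And>a b. a \<in> A \<Longrightarrow> b \<in> B \<Longrightarrow> x a b = y a b"
  shows "between x A B = between y A B"
  unfolding between_def by (intro sum.cong refl assms)

lemma between_ge_entry:
  assumes "finite A" "finite B" "a \<in> A" "b \<in> B"
  shows "x a b \<le> between x A B"
  using between_mono[of A B "{a}" "{b}" x] assms by (simp add: between_def)

lemma even_between_self:
  assumes "finite A" "\<And>a b. a \<in> A \<Longrightarrow> b \<in> A \<Longrightarrow> x a b = x b a" "\<And>a. a \<in> A \<Longrightarrow> x a a = 0"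
  shows "even (between x A A)"
  using assms
proof (induction A rule: finite_induct)
  case (insert a A)
  have "between x {a} A = between x A {a}"
    by (rule between_commute) (use insert.prems in auto)
  moreover have "between x {a} {a} = 0" using insert.prems by (simp add: between_def)
  moreover have "even (between x A A)" using insert by auto
  moreover have "between x (insert a A) (insert a A)
      = between x {a} {a} + between x {a} A + (between x A {a} + between x A A)"
    using insert.hyps between_Un_left[of "{a}" A x "{a} \<union> A"] between_Un_right[of "{a}" A x]
    by simp
  ultimately show ?case by simp
qed simp

text \<open>
  The weights at the vertices of \<open>A\<close> add up to \<open>r * card A\<close>, and those inside \<open>A\<close> are counted twice.
\<close>

lemma cut_parity:
  assumes "finite V" "A \<subseteq> V"
    and "\<And>a b. a \<in> V \<Longrightarrow> b \<in> V \<Longrightarrow> x a b = x b a" "\<And>a. a \<in> V \<Longrightarrow> x a a = 0"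
    and "\<And>a. a \<in> V \<Longrightarrow> (\<Sum>b\<in>V. x a b) = r"
  shows "even (between x A (V - A)) \<longleftrightarrow> even (r * card A)"
proof -
  have "between x A V = (\<Sum>a\<in>A. r)"
    using assms(2,5) unfolding between_def by (intro sum.cong) auto
  then have "r * card A = between x A A + between x A (V - A)"
    using between_split[OF assms(1,2), of x A] by simp
  moreover have "even (between x A A)"
    using assms(2-4) finite_subset[OF assms(2,1)] by (intro even_between_self) blast+
  ultimately show ?thesis by simp
qed

lemma between_compl:
  assumes "A \<subseteq> V" "\<And>a b. a \<in> V \<Longrightarrow> b \<in> V \<Longrightarrow> x a b = x b a"
  shows "between x (V - A) (V - (V - A)) = between x A (V - A)"
proof -
  have "V - (V - A) = A" using assms(1) by blast
  moreover have "between x (V - A) A = between x A (V - A)"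
    by (rule between_commute) (use assms in auto)
  ultimately show ?thesis by simp
qed

text \<open>
  The submodularity of cut sizes, with its exact defect. Both sides are sums over the parts
  \<open>S \<inter> T\<close>, \<open>S - T\<close>, \<open>T - S\<close> and the remaining vertices; only the weight between \<open>S - T\<close> and
  \<open>T - S\<close> is counted by both cuts on the left and by none on the right.
\<close>

lemma between_uncross:
  assumes V: "finite V" "S \<subseteq> V" "T \<subseteq> V"
    and sym: "\<And>a b. a \<in> V \<Longrightarrow> b \<in> V \<Longrightarrow> x a b = x b a"
  shows "between x S (V - S) + between x T (V - T)
       = between x (S \<inter> T) (V - S \<inter> T) + between x (S \<union> T) (V - (S \<union> T))
         + 2 * between x (S - T) (T - S)"
proof -
  define P Q R Z where "P = S \<inter> T" and "Q = S - T" and "R = T - S" and "Z = V - (S \<union> T)"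
  have fin: "finite P" "finite Q" "finite R" "finite Z"
    by (rule finite_subset[OF _ V(1)]; use V in \<open>auto simp: P_def Q_def R_def Z_def\<close>)+
  have disj: "P \<inter> Q = {}" "P \<inter> R = {}" "P \<inter> Z = {}" "Q \<inter> R = {}" "Q \<inter> Z = {}" "R \<inter> Z = {}"
    by (auto simp: P_def Q_def R_def Z_def)
  have eqs: "S = P \<union> Q" "T = P \<union> R" "V - S = R \<union> Z" "V - T = Q \<union> Z"
    "V - S \<inter> T = Q \<union> (R \<union> Z)" "S \<union> T = P \<union> (Q \<union> R)"
    using V by (auto simp: P_def Q_def R_def Z_def)
  have comm: "between x R Q = between x Q R" "between x Q P = between x P Q"
    by (rule between_commute; use V sym in \<open>auto simp: P_def Q_def R_def\<close>)+
  have "between x S (V - S) = between x P R + between x P Z + (between x Q R + between x Q Z)"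
    unfolding eqs(3) unfolding eqs(1) using fin disj by (simp add: between_Un_left between_Un_right)
  moreover have "between x T (V - T) = between x P Q + between x P Z + (between x R Q + between x R Z)"
    unfolding eqs(4) unfolding eqs(2) using fin disj by (simp add: between_Un_left between_Un_right)
  moreover have "between x P (V - S \<inter> T) = between x P Q + (between x P R + between x P Z)"
    unfolding eqs(5) using fin disj by (simp add: between_Un_right Int_Un_distrib)
  moreover have "between x (S \<union> T) Z = between x P Z + (between x Q Z + between x R Z)"
    unfolding eqs(6) using fin disj by (simp add: between_Un_left Int_Un_distrib)
  moreover have "between x (S - T) (T - S) = between x Q R"
    by (simp add: Q_def R_def)
  ultimately show ?thesis
    using comm unfolding P_def[symmetric] Z_def[symmetric] by simp
qed

section \<open>Perfect matchings of r-graphs\<close>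

text \<open>
  Seymour's \<open>r\<close>-graphs: \<open>r\<close>-regular multigraphs, with multiplicities \<open>x\<close>, in which every odd cut
  has at least \<open>r\<close> edges.
\<close>

locale r_graph =
  fixes V :: "'a set" and x :: "'a \<Rightarrow> 'a \<Rightarrow> nat" and r :: nat
  assumes finite_V: "finite V"
    and sym: "a \<in> V \<Longrightarrow> b \<in> V \<Longrightarrow> x a b = x b a"
    and degree: "a \<in> V \<Longrightarrow> (\<Sum>b\<in>V. x a b) = r"
    and odd_cut: "A \<subseteq> V \<Longrightarrow> odd (card A) \<Longrightarrow> r \<le> between x A (V - A)"
    and r_pos: "0 < r"
begin

text \<open>
  The cut around the single vertex \<open>a\<close> already carries the whole degree of \<open>a\<close>.
\<close>

lemma no_loop: "a \<in> V \<Longrightarrow> x a a = 0"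
  using odd_cut[of "{a}"] degree[of a] finite_V by (simp add: between_def sum.remove[of V a])

lemma even_card_V: "even (card V)"
  using odd_cut[of V] r_pos by auto

lemma odd_compl: "A \<subseteq> V \<Longrightarrow> odd (card (V - A)) \<longleftrightarrow> odd (card A)"
proof -
  assume A: "A \<subseteq> V"
  then have "card V = card (V - A) + card A"
    using finite_V by (metis card_Diff_subset card_mono finite_subset le_add_diff_inverse2)
  then show ?thesis using even_card_V by auto
qed

lemma cut_compl: "A \<subseteq> V \<Longrightarrow> between x (V - A) (V - (V - A)) = between x A (V - A)"
  using between_compl sym by blast

lemma parity: "A \<subseteq> V \<Longrightarrow> even (between x A (V - A)) \<longleftrightarrow> even (r * card A)"
  using cut_parity[OF finite_V _ sym no_loop degree] by blast

text \<open>
  The edge count behind Tutte's condition. Each member of \<open>F\<close> sends weight at least \<open>r\<close> to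
  \<open>U \<union> {u, v}\<close>, since it sends none elsewhere. On the other hand these \<open>card U + 2\<close> vertices have
  total degree \<open>r * (card U + 2)\<close>, part of which is spent on the edge between \<open>u\<close> and \<open>v\<close>.
\<close>

lemma isolated_odd_family_bound:
  assumes uv: "u \<in> V" "v \<in> V" "0 < x u v" and U: "U \<subseteq> V - {u, v}"
    and F: "isolated_odd_family (V - {u, v} - U) (\<lambda>a b. a \<in> V \<and> b \<in> V \<and> 0 < x a b) F"
  shows "card F < card U + 2"
proof -
  define U' where "U' = insert u (insert v U)"
  define X where "X = V - U'"
  have X: "V - {u, v} - U = X" by (auto simp: X_def U'_def)
  have ne: "u \<noteq> v" using uv no_loop by auto
  have finU': "finite U'" and finX: "finite X" and U'V: "U' \<subseteq> V"
    using U finite_V finite_subset uv by (auto simp: X_def U'_def)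
  have FX: "A \<subseteq> X" "odd (card A)" "\<And>a b. a \<in> A \<Longrightarrow> b \<in> X - A \<Longrightarrow> x a b = 0" if "A \<in> F" for A
    using F that unfolding X isolated_odd_family_def X_def by auto
  have disj: "\<forall>A\<in>F. \<forall>B\<in>F. A \<noteq> B \<longrightarrow> A \<inter> B = {}"
    using F by (auto simp: isolated_odd_family_def)
  have finA: "\<forall>A\<in>F. finite A" using FX(1) finX finite_subset by blast
  have "r \<le> between x A U'" if "A \<in> F" for A
  proof -
    have "V - A = U' \<union> (X - A)" using FX(1)[OF that] U'V by (auto simp: X_def)
    moreover have "between x A (X - A) = 0" using FX(3)[OF that] by (simp add: between_def)
    moreover have "U' \<inter> (X - A) = {}" by (auto simp: X_def)
    ultimately have "between x A (V - A) = between x A U'"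
      using finU' finX by (simp add: between_Un_right)
    moreover have "A \<subseteq> V" using FX(1)[OF that] by (auto simp: X_def)
    ultimately show ?thesis using odd_cut FX(2)[OF that] by metis
  qed
  then have "(\<Sum>A\<in>F. r) \<le> (\<Sum>A\<in>F. between x A U')" by (rule sum_mono)
  also have "\<dots> = between x (\<Union>F) U'"
    unfolding between_def using disj finA by (subst sum.Union_disjoint) (auto simp: o_def)
  also have "\<dots> \<le> between x X U'"
    using FX(1) finX finU' by (intro between_mono) auto
  also have "\<dots> = between x U' X"
    by (rule between_commute) (use U'V sym in \<open>auto simp: X_def\<close>)
  finally have "r * card F \<le> between x U' X" by (simp add: mult.commute)
  moreover have "between x U' V = between x U' U' + between x U' X"
    using between_split[OF finite_V U'V] by (simp add: X_def)
  moreover have "between x U' V = r * card U'"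
    using U'V degree by (simp add: between_def subset_iff)
  moreover have "0 < between x U' U'"
    using between_ge_entry[of U' U' u v x] uv finU' by (simp add: U'_def)
  moreover have "card U' = card U + 2"
    using ne U finite_subset[OF U] finite_V by (auto simp: U'_def card_insert_if)
  ultimately have "r * card F < r * (card U + 2)" by simp
  then show ?thesis by (metis mult_less_cancel1)
qed

text \<open>
  Tutte's theorem for the graph without \<open>u\<close> and \<open>v\<close>. The bound \<open>isolated_odd_family_bound\<close> exceeds
  by one the bound that is required, and parity makes up for it: a family of \<open>card U + 1\<close> sets leaves an odd
  number of vertices outside \<open>U\<close> uncovered, which could be added to it as a further member.
\<close>

lemma pairing_through_edge:
  assumes uv: "u \<in> V" "v \<in> V" "0 < x u v"
  shows "\<exists>f. pairing V (\<lambda>a b. 0 < x a b) f \<and> f u = v"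
proof -
  define G where "G = (\<lambda>a b. a \<in> V \<and> b \<in> V \<and> 0 < x a b)"
  let ?W = "V - {u, v}"
  have ne: "u \<noteq> v" using uv no_loop by auto
  have Gsym: "G b a" if "G a b" for a b using that sym by (auto simp: G_def)
  have "\<exists>f. pairing ?W G f"
  proof (rule Tutte_pairing)
    show "finite ?W" using finite_V by simp
    show "\<not> G a a" for a using no_loop by (auto simp: G_def)
    show "G b a" if "G a b" for a b using that by (rule Gsym)
    show "card F \<le> card U" if U: "U \<subseteq> ?W" and F: "isolated_odd_family (?W - U) G F" for U F
    proof (rule ccontr)
      assume "\<not> ?thesis"
      moreover have bound: "card F' < card U + 2" if "isolated_odd_family (?W - U) G F'" for F'
        using isolated_odd_family_bound[OF uv U] that by (simp add: G_def)
      ultimately have cF: "card F = card U + 1" using F by fastforce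
      let ?X = "?W - U"
      define R where "R = ?X - \<Union>F"
      have finX: "finite ?X" using finite_V by simp
      have FX: "\<Union>F \<subseteq> ?X" and Fodd: "\<And>A. A \<in> F \<Longrightarrow> odd (card A)"
        and disj: "\<forall>A\<in>F. \<forall>B\<in>F. A \<noteq> B \<longrightarrow> A \<inter> B = {}"
        and iso: "\<And>A a b. A \<in> F \<Longrightarrow> a \<in> A \<Longrightarrow> b \<in> ?X - A \<Longrightarrow> \<not> G a b"
        using F unfolding isolated_odd_family_def by blast+
      have finF: "finite F" using FX finX by (meson finite_UnionD finite_subset)
      have finA: "finite A" if "A \<in> F" for A
        by (rule finite_subset[OF _ finX]) (use FX that in blast)
      have "card (\<Union>F) = (\<Sum>A\<in>F. card A)"
        using disj finA by (intro card_Union_disjoint) (auto simp: pairwise_def disjnt_def)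
      moreover have "even (\<Sum>A\<in>F. card A) \<longleftrightarrow> even (card F)"
      proof -
        have "{A \<in> F. odd (card A)} = F" using Fodd by blast
        then show ?thesis using even_sum_iff[OF finF, of card] by simp
      qed
      moreover have "card ?X = card (\<Union>F) + card R"
        unfolding R_def using FX finX
        by (metis card_Diff_subset card_mono finite_subset le_add_diff_inverse)
      moreover have "card V = card ?X + card U + 2"
      proof -
        have "card V = card ?W + 2"
          using uv ne finite_V card_mono[of V "{u, v}"] by (simp add: card_Diff_subset)
        moreover have "card ?W = card ?X + card U"
          using U finite_V finite_subset[OF U]
          by (metis card_Diff_subset card_mono finite_Diff le_add_diff_inverse2)
        ultimately show ?thesis by simp
      qed
      ultimately have Rodd: "odd (card R)" using even_card_V cF by auto
      then have "R \<noteq> {}" by auto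
      then have "R \<notin> F" by (auto simp: R_def)
      have Riso: "\<not> G a b" if ab: "a \<in> R" "b \<in> ?X - R" for a b
      proof
        assume "G a b"
        then have "G b a" by (rule Gsym)
        moreover obtain A where "A \<in> F" "b \<in> A" using ab by (auto simp: R_def)
        ultimately show False using iso[of A b a] ab by (auto simp: R_def)
      qed
      have "isolated_odd_family ?X G (insert R F)"
        unfolding isolated_odd_family_def
      proof (intro conjI ballI impI)
        fix A assume A: "A \<in> insert R F"
        show "A \<subseteq> ?X" using A FX by (auto simp: R_def)
        show "odd (card A)" using A Fodd Rodd by blast
        show "\<not> G a b" if "a \<in> A" "b \<in> ?X - A" for a b
          using A that iso[of A a b] Riso[of a b] by blast
        show "A \<inter> B = {}" if "B \<in> insert R F" "A \<noteq> B" for B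
          using A that disj by (auto simp: R_def)
      qed
      then have "card (insert R F) < card U + 2" by (rule bound)
      then show False using cF finF \<open>R \<notin> F\<close> by simp
    qed
  qed
  then obtain f where "pairing ?W G f" by blast
  then have f: "pairing ?W (\<lambda>a b. 0 < x a b) f" by (rule pairing_mono) (simp add: G_def)
  have "pairing {u, v} (\<lambda>a b. 0 < x a b) (\<lambda>w. if w = u then v else u)"
    using uv sym by (intro pairing_doubleton) auto
  from pairing_Un[OF this f] have
    "pairing ({u, v} \<union> ?W) (\<lambda>a b. 0 < x a b) (\<lambda>w. if w \<in> {u, v} then (if w = u then v else u) else f w)"
    by blast
  moreover have "{u, v} \<union> ?W = V" using uv by blast
  ultimately show ?thesis by (intro exI[of _ "\<lambda>w. if w \<in> {u, v} then (if w = u then v else u) else f w"]) simp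
qed

end

section \<open>Tight odd cuts\<close>

text \<open>
  The weights after all vertices of \<open>T\<close> have been merged into one. The merged vertex is called \<open>z\<close>;
  choosing \<open>z\<close> from \<open>T\<close> itself keeps the vertex type and makes \<open>z\<close> distinct from all other
  vertices.
\<close>

definition contract :: "('a \<Rightarrow> 'a \<Rightarrow> nat) \<Rightarrow> 'a set \<Rightarrow> 'a \<Rightarrow> 'a \<Rightarrow> 'a \<Rightarrow> nat" where
  "contract x T z a b =
     (if a = z then if b = z then 0 else \<Sum>c\<in>T. x b c
      else if b = z then \<Sum>c\<in>T. x a c else x a b)"

text \<open>
  The incidence weight of a matching. It lets the number of matching edges in a cut be handled
  with the same lemmas as the weight of the cut.
\<close>

definition mate :: "('a \<Rightarrow> 'a) \<Rightarrow> 'a \<Rightarrow> 'a \<Rightarrow> nat" where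
  "mate f a b = (if f a = b then 1 else 0)"

lemma sum_mate: "finite B \<Longrightarrow> (\<Sum>b\<in>B. mate f a b) = (if f a \<in> B then 1 else 0)"
  by (simp add: mate_def)

context r_graph
begin

lemma contract_degree:
  assumes S: "S \<subseteq> V" "z \<in> V - S" and A: "A \<subseteq> S" and a: "a \<in> S"
  shows "(\<Sum>b\<in>insert z S - A. contract x (V - S) z a b) = (\<Sum>b\<in>V - A. x a b)"
proof -
  have fin: "finite (V - S)" "finite (S - A)" using finite_V S by (auto intro: finite_subset)
  have az: "a \<noteq> z" using a S by auto
  have "insert z S - A = insert z (S - A)" "z \<notin> S - A" using A S by auto
  then have "(\<Sum>b\<in>insert z S - A. contract x (V - S) z a b)
      = (\<Sum>c\<in>V - S. x a c) + (\<Sum>b\<in>S - A. contract x (V - S) z a b)"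
    using fin az by (simp add: contract_def)
  also have "(\<Sum>b\<in>S - A. contract x (V - S) z a b) = (\<Sum>b\<in>S - A. x a b)"
    using az S by (intro sum.cong) (auto simp: contract_def)
  also have "(\<Sum>c\<in>V - S. x a c) + (\<Sum>b\<in>S - A. x a b) = (\<Sum>b\<in>(V - S) \<union> (S - A). x a b)"
    using fin by (intro sum.union_disjoint[symmetric]) auto
  also have "(V - S) \<union> (S - A) = V - A" using S A by auto
  finally show ?thesis .
qed

lemma contract_cut:
  assumes "S \<subseteq> V" "z \<in> V - S" "A \<subseteq> S"
  shows "between (contract x (V - S) z) A (insert z S - A) = between x A (V - A)"
  unfolding between_def
  by (intro sum.cong refl contract_degree) (use assms in auto)

text \<open>
  Tightness of \<open>S\<close> gives the merged vertex its degree \<open>r\<close>. Up to complement every odd cut of the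
  contracted graph comes from a subset of \<open>S\<close>, and that one has the same weight in \<open>V\<close>.
\<close>

lemma r_graph_contract:
  assumes S: "S \<subseteq> V" "odd (card S)" "between x S (V - S) = r" "z \<in> V - S"
  shows "r_graph (insert z S) (contract x (V - S) z) r"
proof
  have finS: "finite S" using finite_V S finite_subset by blast
  show "finite (insert z S)" using finS by simp
  show sym': "contract x (V - S) z a b = contract x (V - S) z b a"
    if "a \<in> insert z S" "b \<in> insert z S" for a b
    using that sym S by (auto simp: contract_def)
  show "(\<Sum>b\<in>insert z S. contract x (V - S) z a b) = r" if "a \<in> insert z S" for a
  proof (cases "a = z")
    case True
    have "(\<Sum>b\<in>insert z S. contract x (V - S) z z b) = (\<Sum>b\<in>S. \<Sum>c\<in>V - S. x b c)"
      using finS S by (auto simp: contract_def intro!: sum.cong)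
    then show ?thesis using True S(3) by (simp add: between_def)
  next
    case False
    then show ?thesis using contract_degree[of S z "{}" a] that S degree[of a] by auto
  qed
  show "r \<le> between (contract x (V - S) z) A (insert z S - A)"
    if A: "A \<subseteq> insert z S" "odd (card A)" for A
  proof (cases "z \<in> A")
    case False
    then have "A \<subseteq> S" using A by blast
    then show ?thesis using contract_cut[OF S(1,4), of A] odd_cut[of A] A S by auto
  next
    case True
    let ?B = "insert z S - A"
    have BS: "?B \<subseteq> S" using True by blast
    have "card (insert z S) = Suc (card S)" using S finS by auto
    moreover have "card (insert z S) = card ?B + card A"
      using A finS by (metis card_Diff_subset card_mono finite_insert finite_subset le_add_diff_inverse2)
    ultimately have "odd (card ?B)" using A S by presburger
    moreover have "between (contract x (V - S) z) ?B (insert z S - ?B)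
        = between (contract x (V - S) z) A (insert z S - A)"
      using A(1) sym' by (rule between_compl)
    ultimately show ?thesis using contract_cut[OF S(1,4) BS] odd_cut[of ?B] BS S by auto
  qed
qed (rule r_pos)

text \<open>
  Gluing changes the partner of a single vertex \<open>p\<close> of \<open>S\<close>, from the merged vertex \<open>z\<close> to a vertex
  \<open>q\<close> outside \<open>S\<close>; cuts inside \<open>S\<close> do not see the difference.
\<close>

lemma mate_half:
  assumes S: "S \<subseteq> V" "z \<in> V - S" "q \<in> V - S" and A: "A \<subseteq> S"
    and g: "pairing (insert z S) G g" "g z = p"
    and f: "\<And>v. v \<in> S \<Longrightarrow> f v = (if v = p then q else g v)"
  shows "between (mate f) A (V - A) = between (mate g) A (insert z S - A)"
  unfolding between_def
proof (rule sum.cong[OF refl])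
  fix a assume a: "a \<in> A"
  have fin: "finite (V - A)" "finite (insert z S - A)"
    using finite_V S finite_subset[OF S(1)] by auto
  have gg: "g v \<in> insert z S" "g (g v) = v" if "v \<in> insert z S" for v
    using g(1) that by (auto simp: pairing_def)
  have "f a \<in> V - A \<longleftrightarrow> g a \<in> insert z S - A"
  proof (cases "a = p")
    case True
    then have "g a = z" using gg(2)[of z] g(2) by simp
    then show ?thesis using True f[of a] a A S by auto
  next
    case False
    have "g a \<noteq> z" using gg(2)[of a] g(2) False a A by auto
    then show ?thesis using False f[of a] a A S gg(1)[of a] by (auto simp: subset_iff)
  qed
  then show "(\<Sum>b\<in>V - A. mate f a b) = (\<Sum>b\<in>insert z S - A. mate g a b)"
    using fin by (simp add: sum_mate)
qed

definition tight :: "'a set \<Rightarrow> bool" where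
  "tight A \<longleftrightarrow> A \<subseteq> V \<and> odd (card A) \<and> between x A (V - A) = r"

lemma tight_compl: "tight A \<Longrightarrow> tight (V - A)"
  using cut_compl odd_compl by (auto simp: tight_def)

lemma mate_sym:
  assumes "pairing V G f" "a \<in> V" "b \<in> V"
  shows "mate f a b = mate f b a"
  using assms by (auto simp: mate_def pairing_def)

text \<open>
  If \<open>S \<inter> T\<close> is odd, so is \<open>S \<union> T\<close>. Both have weight at least \<open>r\<close>, and the sum for \<open>S\<close> and \<open>T\<close> is
  \<open>2 r\<close>; by \<open>between_uncross\<close> both are tight and no edge joins \<open>S - T\<close> to \<open>T - S\<close>. The same
  identity for the matching then expresses its number of edges in the cut of \<open>T\<close> through cuts that
  are contained in \<open>S\<close> or, after complementation, in \<open>V - S\<close>.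
\<close>

lemma mate_tight_by_uncrossing:
  assumes f: "pairing V (\<lambda>a b. 0 < x a b) f"
    and S: "tight S" "between (mate f) S (V - S) = 1"
    and inner: "\<And>A. tight A \<Longrightarrow> A \<subseteq> S \<Longrightarrow> between (mate f) A (V - A) = 1"
    and outer: "\<And>A. tight A \<Longrightarrow> A \<subseteq> V - S \<Longrightarrow> between (mate f) A (V - A) = 1"
    and T: "tight T" "odd (card (S \<inter> T))"
  shows "between (mate f) T (V - T) = 1"
proof -
  have SV: "S \<subseteq> V" and TV: "T \<subseteq> V" using S T by (auto simp: tight_def)
  have fin: "finite S" "finite T" using SV TV finite_V finite_subset by auto
  have "card (S \<union> T) + card (S \<inter> T) = card S + card T"
    using card_Un_Int[OF fin] by simp
  moreover have "odd (card S)" "odd (card T)" using S T by (auto simp: tight_def)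
  ultimately have odd_Un: "odd (card (S \<union> T))" using T(2) by presburger
  have IV: "S \<inter> T \<subseteq> V" and UV: "S \<union> T \<subseteq> V" using SV TV by auto
  have rST: "between x S (V - S) = r" "between x T (V - T) = r" using S T by (auto simp: tight_def)
  have "r + r = between x (S \<inter> T) (V - S \<inter> T) + between x (S \<union> T) (V - (S \<union> T))
         + 2 * between x (S - T) (T - S)"
    using between_uncross[of V S T x, OF finite_V SV TV sym] unfolding rST .
  moreover have "r \<le> between x (S \<inter> T) (V - S \<inter> T)" using odd_cut IV T(2) by blast
  moreover have "r \<le> between x (S \<union> T) (V - (S \<union> T))" using odd_cut UV odd_Un by blast
  ultimately have cap: "tight (S \<inter> T)" and cup: "tight (S \<union> T)"
    and zero: "between x (S - T) (T - S) = 0"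
    using IV UV T(2) odd_Un by (auto simp: tight_def)
  have x0: "x a b = 0" if "a \<in> S - T" "b \<in> T - S" for a b
    using between_ge_entry[of "S - T" "T - S" a b x] zero that fin by simp
  have "f a \<noteq> b" if "a \<in> S - T" "b \<in> T - S" for a b
    using f x0[OF that] that SV unfolding pairing_def by force
  then have "between (mate f) (S - T) (T - S) = 0"
    by (simp add: between_def mate_def)
  moreover have "between (mate f) S (V - S) + between (mate f) T (V - T)
       = between (mate f) (S \<inter> T) (V - S \<inter> T) + between (mate f) (S \<union> T) (V - (S \<union> T))
         + 2 * between (mate f) (S - T) (T - S)"
    using between_uncross[OF finite_V SV TV mate_sym[OF f]] .
  moreover have "between (mate f) (S \<inter> T) (V - S \<inter> T) = 1" using inner cap by blast
  moreover have "between (mate f) (S \<union> T) (V - (S \<union> T)) = 1"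
    using outer[OF tight_compl[OF cup]] between_compl[OF UV mate_sym[OF f]] by auto
  ultimately show ?thesis using S(2) by simp
qed

text \<open>
  The matching \<open>g\<close> lives on \<open>S\<close> and the contracted outside \<open>z\<close>, the matching \<open>h\<close> on \<open>V - S\<close> and the
  contracted inside, for which \<open>p\<close> itself serves as the name. Thus \<open>h p = q\<close> already is the edge
  \<open>p q\<close> of the original graph, and only the partner \<open>z\<close> of \<open>p\<close> under \<open>g\<close> has to be replaced by \<open>q\<close>.
  A tight set, being odd, has an odd intersection with \<open>S\<close> or with \<open>V - S\<close>, and is uncrossed with
  that side.
\<close>

lemma mate_tight_glue:
  assumes S: "tight S" "z \<in> V - S" "p \<in> S" "q \<in> V - S" "0 < x p q"
    and g: "pairing (insert z S) (\<lambda>a b. 0 < contract x (V - S) z a b) g" "g z = p"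
      "\<And>A. r_graph.tight (insert z S) (contract x (V - S) z) r A \<Longrightarrow>
        between (mate g) A (insert z S - A) = 1"
    and h: "pairing (insert p (V - S)) (\<lambda>a b. 0 < contract x S p a b) h" "h p = q"
      "\<And>A. r_graph.tight (insert p (V - S)) (contract x S p) r A \<Longrightarrow>
        between (mate h) A (insert p (V - S) - A) = 1"
    and f_def: "f = (\<lambda>v. if v \<in> S then if v = p then q else g v else h v)"
  shows "pairing V (\<lambda>a b. 0 < x a b) f \<and> (\<forall>A. tight A \<longrightarrow> between (mate f) A (V - A) = 1)"
proof -
  have SV: "S \<subseteq> V" using S by (auto simp: tight_def)
  have VVS: "V - (V - S) = S" using SV by blast
  interpret g: r_graph "insert z S" "contract x (V - S) z" r
    using S by (intro r_graph_contract) (auto simp: tight_def)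
  have "r_graph (insert p (V - S)) (contract x (V - (V - S)) p) r"
    using S tight_compl[OF S(1)] by (intro r_graph_contract) (auto simp: tight_def)
  then interpret h: r_graph "insert p (V - S)" "contract x S p" r
    by (simp only: VVS)
  have gg: "g v \<in> insert z S" "g (g v) = v" "0 < contract x (V - S) z v (g v)" if "v \<in> insert z S" for v
    using g(1) that by (auto simp: pairing_def)
  have hh: "h v \<in> insert p (V - S)" "h (h v) = v" "0 < contract x S p v (h v)" if "v \<in> insert p (V - S)" for v
    using h(1) that by (auto simp: pairing_def)
  have gp: "g p = z" using gg(2)[of z] g(2) by simp
  have hq: "h q = p" using hh(2)[of p] h(2) by simp
  have pairing_f: "pairing V (\<lambda>a b. 0 < x a b) f"
    unfolding pairing_def
  proof (intro ballI)
    fix v assume v: "v \<in> V"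
    consider "v = p" | "v \<in> S" "v \<noteq> p" | "v = q" | "v \<notin> S" "v \<noteq> q" by blast
    then show "f v \<in> V \<and> f (f v) = v \<and> 0 < x v (f v)"
    proof cases
      case 1
      then show ?thesis using S hq by (auto simp: f_def)
    next
      case 2
      have "g v \<noteq> z" using gg(2)[of v] g(2) 2 by auto
      moreover have "g v \<noteq> p" using gg(2)[of v] gp 2 S by auto
      ultimately show ?thesis using 2 gg[of v] S SV by (auto simp: f_def contract_def split: if_splits)
    next
      case 3
      then show ?thesis using S hq SV sym[of p q] by (auto simp: f_def)
    next
      case 4
      have "h v \<noteq> p" using hh(2)[of v] h(2) 4 v by auto
      then have "h v \<in> V - S" using hh(1)[of v] 4 v by auto
      moreover have "v \<noteq> p" using 4 S by auto
      ultimately show ?thesis using 4 hh[of v] v \<open>h v \<noteq> p\<close> by (auto simp: f_def contract_def)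
    qed
  qed
  have inner: "between (mate f) A (V - A) = 1" if A: "tight A" "A \<subseteq> S" for A
  proof -
    have "g.tight A"
      using A contract_cut[OF SV S(2) A(2)] by (auto simp: tight_def g.tight_def)
    then have "between (mate g) A (insert z S - A) = 1" by (rule g(3))
    moreover have "between (mate f) A (V - A) = between (mate g) A (insert z S - A)"
      by (rule mate_half[OF SV S(2) S(4) A(2) g(1,2)]) (simp add: f_def)
    ultimately show ?thesis by simp
  qed
  have outer: "between (mate f) A (V - A) = 1" if A: "tight A" "A \<subseteq> V - S" for A
  proof -
    have p: "p \<in> V - (V - S)" using S SV by blast
    have "h.tight A"
      using A contract_cut[of "V - S", OF _ p A(2)] by (auto simp: tight_def h.tight_def VVS)
    then have "between (mate h) A (insert p (V - S) - A) = 1" by (rule h(3))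
    moreover have "between (mate f) A (V - A) = between (mate h) A (insert p (V - S) - A)"
      by (rule mate_half[OF _ p p A(2) h(1,2)]) (use hq in \<open>auto simp: f_def\<close>)
    ultimately show ?thesis by simp
  qed
  have S1: "between (mate f) S (V - S) = 1" using inner S by blast
  have "between (mate f) T (V - T) = 1" if T: "tight T" for T
  proof (cases "odd (card (S \<inter> T))")
    case True
    then show ?thesis using mate_tight_by_uncrossing[OF pairing_f S(1) S1 inner outer T] by blast
  next
    case False
    have "finite T" using T finite_V finite_subset by (auto simp: tight_def)
    then have "card T = card (S \<inter> T) + card (T - S)"
      by (metis Int_commute card_Int_Diff)
    then have "odd (card (T - S))" using False T by (auto simp: tight_def)
    moreover have "(V - S) \<inter> T = T - S" using T by (auto simp: tight_def)
    ultimately have "odd (card ((V - S) \<inter> T))" by simp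
    then show ?thesis
      using mate_tight_by_uncrossing[OF pairing_f tight_compl[OF S(1)] _ outer _ T]
        outer[OF tight_compl[OF S(1)]] inner VVS by (metis subset_refl)
  qed
  then show ?thesis using pairing_f by blast
qed

end

text \<open>
  The prescribed edge is what makes the induction work: the matching on one side of a tight cut determines an edge of the
  cut, and the matching on the other side has to contain the same edge.
\<close>

theorem r_graph_matching_through_edge:
  assumes "r_graph V x r" "u \<in> V" "v \<in> V" "0 < x u v"
  shows "\<exists>f. pairing V (\<lambda>a b. 0 < x a b) f \<and> f u = v \<and>
    (\<forall>A. r_graph.tight V x r A \<longrightarrow> between (mate f) A (V - A) = 1)"
  using assms
proof (induction "card V" arbitrary: V x u v rule: less_induct)
  case less
  interpret r_graph V x r by fact
  note uv = less.prems(2-4)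
  show ?case
  proof (cases "\<exists>S. tight S \<and> 1 < card S \<and> 1 < card (V - S)")
    case False
    \<comment> \<open>Only the cuts around single vertices are tight, and every perfect matching meets them once.\<close>
    obtain f where f: "pairing V (\<lambda>a b. 0 < x a b) f" "f u = v"
      using pairing_through_edge[OF uv] by blast
    have ff: "f a \<in> V" "f (f a) = a" "f a \<noteq> a" if "a \<in> V" for a
      using f(1) that no_loop unfolding pairing_def by (blast, blast, fastforce)
    have single: "between (mate f) {a} (V - {a}) = 1" if "a \<in> V" for a
      using ff[OF that] that finite_V by (simp add: between_def sum_mate)
    have "between (mate f) A (V - A) = 1" if A: "tight A" for A
    proof -
      have AV: "A \<subseteq> V" and oddA: "odd (card A)" using A by (auto simp: tight_def)
      then have "odd (card (V - A))" using odd_compl by blast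
      moreover have "card A \<le> 1 \<or> card (V - A) \<le> 1" using False A by (meson not_le)
      ultimately have "card A = 1 \<or> card (V - A) = 1" using oddA by (metis One_nat_def le_Suc_eq le_zero_eq odd_pos not_gr_zero)
      then show ?thesis
      proof
        assume "card A = 1"
        then obtain a where "A = {a}" by (rule card_1_singletonE)
        then show ?thesis using single AV by auto
      next
        assume "card (V - A) = 1"
        then obtain a where a: "V - A = {a}" by (rule card_1_singletonE)
        then have "between (mate f) (V - A) (V - (V - A)) = 1" using single[of a] by auto
        then show ?thesis
          using between_compl[of A V "mate f", OF AV mate_sym[OF f(1)]] by simp
      qed
    qed
    then show ?thesis using f by blast
  next
    case True
    then obtain S' where S': "tight S'" "1 < card S'" "1 < card (V - S')" by blast
    have "\<exists>S. tight S \<and> 1 < card S \<and> 1 < card (V - S) \<and> u \<in> S"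
    proof (cases "u \<in> S'")
      case False
      have "V - (V - S') = S'" using S' by (auto simp: tight_def)
      then show ?thesis using S' False uv tight_compl[of S'] by (intro exI[of _ "V - S'"]) auto
    qed (use S' in blast)
    then obtain S where S: "tight S" "1 < card S" "1 < card (V - S)" "u \<in> S" by blast
    have SV: "S \<subseteq> V" using S by (auto simp: tight_def)
    have VVS: "V - (V - S) = S" using SV by blast
    have finS: "finite S" using SV finite_V finite_subset by blast
    have cardV: "card V = card S + card (V - S)"
      using SV finite_V finS by (metis card_Diff_subset card_mono le_add_diff_inverse)
    have "V - S \<noteq> {}" using S(3) by (metis card.empty not_less_zero)
    then obtain z where z: "z \<in> V - S" by blast
    let ?x1 = "contract x (V - S) z"
    interpret g: r_graph "insert z S" ?x1 r
      using S z by (intro r_graph_contract) (auto simp: tight_def)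
    have c1: "card (insert z S) < card V" using z finS S cardV by simp
    \<comment> \<open>The image of \<open>v\<close> in the graph where \<open>V - S\<close> is contracted.\<close>
    define w where "w = (if v \<in> S then v else z)"
    have pos_sum: "0 < (\<Sum>c\<in>B. x a c)" if "b \<in> B" "B \<subseteq> V" "0 < x a b" for a b B
      using that finite_subset[OF that(2) finite_V] by (metis gr_zeroI sum_eq_0_iff less_numeral_extra(3))
    have "0 < ?x1 u w"
      using uv S z pos_sum[of v "V - S" u] by (auto simp: w_def contract_def)
    moreover have "u \<in> insert z S" "w \<in> insert z S" using S(4) by (auto simp: w_def)
    ultimately obtain g where g: "pairing (insert z S) (\<lambda>a b. 0 < ?x1 a b) g" "g u = w"
      "\<And>A. g.tight A \<Longrightarrow> between (mate g) A (insert z S - A) = 1"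
      using less.hyps[OF c1 g.r_graph_axioms, of u w] by blast
    have gz: "g z \<in> insert z S" "g (g z) = z" "0 < ?x1 z (g z)"
      using g(1) by (auto simp: pairing_def)
    define p where "p = g z"
    have pz: "p \<noteq> z" using gz(3) by (auto simp: p_def contract_def)
    then have p: "p \<in> S" using gz by (simp add: p_def)
    \<comment> \<open>If the prescribed edge \<open>u v\<close> crosses the cut, it has to be the edge along which the two matchings
      are glued; otherwise any edge from \<open>p\<close> to \<open>V - S\<close> will do.\<close>
    have "\<exists>q. q \<in> V - S \<and> 0 < x p q \<and> (u = p \<longrightarrow> q = v) \<and> (u \<noteq> p \<longrightarrow> v \<in> S)"
    proof (cases "u = p")
      case True
      then have "w = z" using g(2) gz(2) by (simp add: p_def)
      then have "v \<notin> S" using z by (auto simp: w_def)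
      then show ?thesis using True uv by auto
    next
      case False
      have "v \<in> S"
      proof (rule ccontr)
        assume "v \<notin> S"
        then have "g u = z" using g(2) by (simp add: w_def)
        moreover have "g (g u) = u" using g(1) S(4) by (auto simp: pairing_def)
        ultimately show False using False by (simp add: p_def)
      qed
      have "0 < (\<Sum>c\<in>V - S. x p c)" using gz(3) pz by (auto simp: p_def contract_def)
      then obtain q where "q \<in> V - S" "0 < x p q" by (metis gr_zeroI sum.neutral less_numeral_extra(3))
      then show ?thesis using False \<open>v \<in> S\<close> by blast
    qed
    then obtain q where q: "q \<in> V - S" "0 < x p q" "u = p \<Longrightarrow> q = v" "u \<noteq> p \<Longrightarrow> v \<in> S" by blast
    let ?x2 = "contract x S p"
    have "r_graph (insert p (V - S)) (contract x (V - (V - S)) p) r"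
      using S p tight_compl[OF S(1)] SV by (intro r_graph_contract) (auto simp: tight_def)
    then interpret h: r_graph "insert p (V - S)" ?x2 r by (simp only: VVS)
    have c2: "card (insert p (V - S)) < card V" using p finite_V S cardV by simp
    have "0 < x q p" using q(1,2) sym[of p q] p SV by auto
    then have "0 < (\<Sum>c\<in>S. x q c)" using pos_sum p SV by blast
    then have "0 < ?x2 p q" using q(1) p by (auto simp: contract_def)
    moreover have "p \<in> insert p (V - S)" "q \<in> insert p (V - S)" using q(1) by auto
    ultimately obtain h where h: "pairing (insert p (V - S)) (\<lambda>a b. 0 < ?x2 a b) h" "h p = q"
      "\<And>A. h.tight A \<Longrightarrow> between (mate h) A (insert p (V - S) - A) = 1"
      using less.hyps[OF c2 h.r_graph_axioms, of p q] by blast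
    define f where "f = (\<lambda>v. if v \<in> S then if v = p then q else g v else h v)"
    have "pairing V (\<lambda>a b. 0 < x a b) f \<and> (\<forall>A. tight A \<longrightarrow> between (mate f) A (V - A) = 1)"
      by (rule mate_tight_glue[OF S(1) z p q(1,2) g(1) p_def[symmetric] g(3) h f_def])
    moreover have "f u = v" using S(4) q(3,4) g(2) by (auto simp: f_def w_def)
    ultimately show ?thesis by blast
  qed
qed

section \<open>A sequence of matchings\<close>

text \<open>
  A tight cut loses one edge of the matching and gains at least three edges of \<open>y\<close>. An odd cut
  that is not tight has weight at least \<open>r + 2\<close> by parity, and loses no more than it gains.
\<close>

lemma r_graph_add_remove_matching:
  assumes "r_graph V y 3" "r_graph V x r" "odd r" "V \<noteq> {}"
    and xy: "\<And>a b. a \<in> V \<Longrightarrow> b \<in> V \<Longrightarrow> y a b \<le> x a b"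
      "\<And>a b. a \<in> V \<Longrightarrow> b \<in> V \<Longrightarrow> 0 < x a b \<Longrightarrow> 0 < y a b"
  shows "\<exists>f. pairing V (\<lambda>a b. 0 < y a b) f \<and>
    r_graph V (\<lambda>a b. y a b + (x a b - mate f a b)) (r + 2)"
proof -
  interpret x: r_graph V x r by fact
  interpret y: r_graph V y 3 by fact
  obtain u where u: "u \<in> V" using assms by blast
  then have "(\<Sum>b\<in>V. x u b) \<noteq> 0" using x.degree x.r_pos by simp
  then obtain v where v: "v \<in> V" "0 < x u v" by (metis gr_zeroI sum.neutral)
  obtain f where f: "pairing V (\<lambda>a b. 0 < x a b) f"
    and tight: "\<And>A. x.tight A \<Longrightarrow> between (mate f) A (V - A) = 1"
    using r_graph_matching_through_edge[of V x r u v, OF x.r_graph_axioms u v] by blast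
  have fV: "f a \<in> V" if "a \<in> V" for a using f that by (auto simp: pairing_def)
  have mate_y: "mate f a b \<le> y a b" if "a \<in> V" for a b
    using f xy(2)[of a "f a"] that by (auto simp: mate_def pairing_def Suc_le_eq)
  have mate_x: "mate f a b \<le> x a b" if "a \<in> V" "b \<in> V" for a b
    using mate_y[OF that(1), of b] xy(1)[OF that] by simp
  define x' where "x' = (\<lambda>a b. y a b + (x a b - mate f a b))"
  have x'_eq: "x' a b + mate f a b = y a b + x a b" if "a \<in> V" "b \<in> V" for a b
    using mate_x[OF that] by (simp add: x'_def)
  have cut_eq: "between x' A (V - A) + between (mate f) A (V - A)
      = between y A (V - A) + between x A (V - A)" if "A \<subseteq> V" for A
    unfolding between_add[symmetric] by (rule between_cong) (use x'_eq that in auto)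
  have "r_graph V x' (r + 2)"
  proof
    show "finite V" by (rule x.finite_V)
    show "x' a b = x' b a" if "a \<in> V" "b \<in> V" for a b
      using that x.sym y.sym x.mate_sym[OF f] by (simp add: x'_def)
    show "(\<Sum>b\<in>V. x' a b) = r + 2" if a: "a \<in> V" for a
    proof -
      have "(\<Sum>b\<in>V. x' a b) + (\<Sum>b\<in>V. mate f a b) = (\<Sum>b\<in>V. y a b) + (\<Sum>b\<in>V. x a b)"
        unfolding sum.distrib[symmetric] using x'_eq a by (intro sum.cong) auto
      then show ?thesis using a x.degree y.degree fV x.finite_V by (simp add: sum_mate)
    qed
    show "r + 2 \<le> between x' A (V - A)" if A: "A \<subseteq> V" "odd (card A)" for A
    proof (cases "x.tight A")
      case True
      then show ?thesis
        using cut_eq[OF A(1)] tight[OF True] y.odd_cut[OF A] by (simp add: x.tight_def)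
    next
      case False
      then have "between x A (V - A) \<noteq> r" using A by (simp add: x.tight_def)
      moreover have "odd (between x A (V - A))" using x.parity[OF A(1)] A(2) assms(3) by simp
      moreover from this have "between x A (V - A) \<noteq> r + 1" using assms(3) by (metis even_plus_one_iff)
      ultimately have "r + 2 \<le> between x A (V - A)" using x.odd_cut[OF A] by linarith
      moreover have "between (mate f) A (V - A) \<le> between y A (V - A)"
        by (rule between_mono_weight) (use mate_y A in auto)
      ultimately show ?thesis using cut_eq[OF A(1)] by simp
    qed
  qed simp
  moreover have "pairing V (\<lambda>a b. 0 < y a b) f"
    using f by (rule pairing_mono) (use xy(2) fV in auto)
  ultimately show ?thesis unfolding x'_def by blast
qed

text \<open>
  The identity at the end says that \<open>x\<close> is \<open>t + 1\<close> copies of \<open>y\<close> with the \<open>t\<close> matchings removed. That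
  \<open>y\<close> stays below \<open>x\<close> is part of the induction: the edge that a matching removes is put back with
  the next copy of \<open>y\<close>.
\<close>

lemma r_graph_matching_sequence:
  assumes y: "r_graph V y 3" and "V \<noteq> {}"
  shows "\<exists>f x. (\<forall>i\<in>{1..t}. pairing V (\<lambda>a b. 0 < y a b) (f i)) \<and> r_graph V x (2 * t + 3) \<and>
    (\<forall>a\<in>V. \<forall>b\<in>V. y a b \<le> x a b \<and> x a b + (\<Sum>i\<in>{1..t}. mate (f i) a b) = (t + 1) * y a b)"
proof (induction t)
  case 0
  then show ?case using y by auto
next
  case (Suc t)
  then obtain f x where f: "\<forall>i\<in>{1..t}. pairing V (\<lambda>a b. 0 < y a b) (f i)"
    and x: "r_graph V x (2 * t + 3)"
    and xy: "\<And>a b. a \<in> V \<Longrightarrow> b \<in> V \<Longrightarrow> y a b \<le> x a b"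
      "\<And>a b. a \<in> V \<Longrightarrow> b \<in> V \<Longrightarrow> x a b + (\<Sum>i\<in>{1..t}. mate (f i) a b) = (t + 1) * y a b"
    by blast
  have pos: "0 < y a b" if "a \<in> V" "b \<in> V" "0 < x a b" for a b
    using xy(2)[OF that(1,2)] that(3) by (cases "y a b") auto
  obtain g where g: "pairing V (\<lambda>a b. 0 < y a b) g"
    and x': "r_graph V (\<lambda>a b. y a b + (x a b - mate g a b)) (2 * t + 3 + 2)"
    using r_graph_add_remove_matching[of V y x "2 * t + 3", OF y x _ assms(2)] xy(1) pos by auto
  define f' where "f' = f(Suc t := g)"
  have "\<forall>i\<in>{1..Suc t}. pairing V (\<lambda>a b. 0 < y a b) (f' i)"
    using f g by (auto simp: f'_def le_Suc_eq)
  moreover have "y a b + (x a b - mate g a b) + (\<Sum>i\<in>{1..Suc t}. mate (f' i) a b) = (Suc t + 1) * y a b"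
    if "a \<in> V" "b \<in> V" for a b
  proof -
    have "(\<Sum>i\<in>{1..t}. mate (f' i) a b) = (\<Sum>i\<in>{1..t}. mate (f i) a b)"
      by (rule sum.cong) (auto simp: f'_def)
    moreover have "mate g a b \<le> y a b"
      using g that(1) by (auto simp: mate_def pairing_def Suc_le_eq)
    ultimately show ?thesis using xy(1)[OF that] xy(2)[OF that] by (simp add: f'_def)
  qed
  ultimately show ?case using x'
    by (intro exI[of _ f'] exI[of _ "\<lambda>a b. y a b + (x a b - mate g a b)"]) (simp add: add.commute)
qed

section \<open>Bridgeless cubic graphs\<close>

definition adj :: "'a set set \<Rightarrow> 'a \<Rightarrow> 'a \<Rightarrow> nat" where
  "adj E a b = (if {a, b} \<in> E then 1 else 0)"

lemma adj_commute: "adj E a b = adj E b a"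
  by (simp add: adj_def insert_commute)

lemma between_adj:
  assumes "finite A" "finite B"
  shows "between (adj E) A B = card {(a, b) \<in> A \<times> B. {a, b} \<in> E}"
proof -
  have "between (adj E) A B = (\<Sum>p\<in>A \<times> B. if {fst p, snd p} \<in> E then 1 else 0)"
    by (simp add: between_def adj_def sum.cartesian_product case_prod_beta)
  also have "\<dots> = card {p \<in> A \<times> B. {fst p, snd p} \<in> E}"
    using assms by (simp flip: sum.inter_filter)
  also have "{p \<in> A \<times> B. {fst p, snd p} \<in> E} = {(a, b) \<in> A \<times> B. {a, b} \<in> E}" by auto
  finally show ?thesis .
qed

context fin_simple_graph
begin

lemma edge_ne: "{a, b} \<in> E \<Longrightarrow> a \<noteq> b"
  using edge_ends[of "{a, b}"] by auto

lemma edge_in_V: "{a, b} \<in> E \<Longrightarrow> a \<in> V" "{a, b} \<in> E \<Longrightarrow> b \<in> V"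
  using edge_ends[of "{a, b}"] by auto

lemma edge_at:
  assumes "e \<in> E" "a \<in> e"
  obtains b where "e = {a, b}"
proof -
  have "card e = 2" using edge_ends assms by blast
  then obtain c d where "e = {c, d}" by (meson card_2_iff)
  then show thesis using that assms(2) by (auto simp: insert_commute)
qed

lemma degree_adj: "(\<Sum>b\<in>V. adj E a b) = vertex_degree E a"
proof -
  have "(\<Sum>b\<in>V. adj E a b) = card {b \<in> V. {a, b} \<in> E}"
    using finite_verts by (simp add: adj_def flip: sum.inter_filter)
  also have "\<dots> = card {e \<in> E. a \<in> e}"
  proof (rule bij_betw_same_card)
    show "bij_betw (\<lambda>b. {a, b}) {b \<in> V. {a, b} \<in> E} {e \<in> E. a \<in> e}"
      unfolding bij_betw_def
    proof
      show "inj_on (\<lambda>b. {a, b}) {b \<in> V. {a, b} \<in> E}" by (auto simp: inj_on_def doubleton_eq_iff)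
      show "(\<lambda>b. {a, b}) ` {b \<in> V. {a, b} \<in> E} = {e \<in> E. a \<in> e}"
      proof
        show "{e \<in> E. a \<in> e} \<subseteq> (\<lambda>b. {a, b}) ` {b \<in> V. {a, b} \<in> E}"
        proof
          fix e assume e: "e \<in> {e \<in> E. a \<in> e}"
          then obtain b where "e = {a, b}" using edge_at by blast
          then show "e \<in> (\<lambda>b. {a, b}) ` {b \<in> V. {a, b} \<in> E}" using e edge_in_V by blast
        qed
      qed auto
    qed
  qed
  finally show ?thesis by (simp add: vertex_degree_def)
qed

text \<open>
  By parity an odd cut with fewer than three edges has exactly one edge, and this edge is a bridge.
\<close>

lemma r_graph_adj:
  assumes "cubic_graph V E" "bridgeless_graph V E"
  shows "r_graph V (adj E) 3"
proof
  show "finite V" by (rule finite_verts)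
  show "adj E a b = adj E b a" for a b by (rule adj_commute)
  show degree: "(\<Sum>b\<in>V. adj E a b) = 3" if "a \<in> V" for a
    using assms(1) that by (simp add: degree_adj cubic_graph_def regular_graph_def)
  show "3 \<le> between (adj E) A (V - A)" if A: "A \<subseteq> V" "odd (card A)" for A
  proof (rule ccontr)
    assume "\<not> ?thesis"
    moreover have "odd (between (adj E) A (V - A))"
    proof -
      have "adj E a a = 0" for a using edge_ne[of a a] by (auto simp: adj_def)
      then show ?thesis
        using cut_parity[of V A "adj E" 3, OF finite_verts A(1) adj_commute _ degree] A(2) by simp
    qed
    ultimately have "between (adj E) A (V - A) = 1" by (auto elim!: oddE)
    then have "card {(a, b) \<in> A \<times> (V - A). {a, b} \<in> E} = 1"
      using between_adj[of A "V - A" E] finite_verts A(1) finite_subset by (metis finite_Diff)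
    then obtain p where p: "{(a, b) \<in> A \<times> (V - A). {a, b} \<in> E} = {p}"
      by (rule card_1_singletonE)
    obtain a0 b0 where ab: "p = (a0, b0)" by (cases p)
    have e0: "a0 \<in> A" "b0 \<in> V - A" "{a0, b0} \<in> E" using p ab by auto
    have only: "a = a0 \<and> b = b0" if "a \<in> A" "b \<in> V - A" "{a, b} \<in> E" for a b
    proof -
      have "(a, b) \<in> {(a, b) \<in> A \<times> (V - A). {a, b} \<in> E}" using that by simp
      then show ?thesis unfolding p ab by simp
    qed
    have "graph_connected V (E - {{a0, b0}})"
      using assms(2) e0 by (auto simp: bridgeless_graph_def)
    then have "(a0, b0) \<in> (adjacency (E - {{a0, b0}}))\<^sup>*"
      using e0 A by (auto simp: graph_connected_def)
    then have "b0 \<in> A"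
    proof (induction rule: rtrancl_induct)
      case base
      show ?case by (rule e0)
    next
      case (step w w')
      then have e: "{w, w'} \<in> E" "{w, w'} \<noteq> {a0, b0}" by (auto simp: adjacency_def)
      then show ?case using only[of w w'] step.IH edge_in_V by blast
    qed
    then show False using e0 by blast
  qed
qed simp

text \<open>
  Let \<open>A\<close> be one of the components that arise when \<open>C\<close> is deleted. The edges leaving \<open>A\<close> all lie in
  \<open>C\<close> and already disconnect the graph; by minimality they are all of \<open>C\<close>.
\<close>

lemma minimal_cut_is_coboundary:
  assumes "graph_connected V E" "minimal_edge_cut V E C"
  obtains A where "A \<subseteq> V" "C = {e \<in> E. \<exists>a\<in>A. \<exists>b\<in>V - A. e = {a, b}}"
proof -
  have comp_eq: "graph_components V F = (\<lambda>u. {w \<in> V. (u, w) \<in> (adjacency F)\<^sup>*}) ` V" for F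
    by (auto simp: graph_components_def quotient_def)
  have one: "card (graph_components V F) = 1" if "graph_connected V F" for F
  proof -
    have "graph_components V F = {V}"
      using that unfolding comp_eq graph_connected_def by auto
    then show ?thesis by simp
  qed
  have two: "1 < card (graph_components V F)" if "u \<in> V" "v \<in> V" "(u, v) \<notin> (adjacency F)\<^sup>*" for F u v
  proof -
    let ?c = "\<lambda>u. {w \<in> V. (u, w) \<in> (adjacency F)\<^sup>*}"
    have "v \<in> ?c v" "v \<notin> ?c u" using that by auto
    then have "card {?c u, ?c v} = 2" by (metis (no_types, lifting) card_2_iff)
    moreover have "card {?c u, ?c v} \<le> card (graph_components V F)"
      unfolding comp_eq using that finite_verts by (intro card_mono) auto
    ultimately show ?thesis by simp
  qed
  have cut: "C \<subseteq> E" "card (graph_components V (E - C)) > 1"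
    using assms one[of E] by (auto simp: minimal_edge_cut_def edge_cut_def)
  have "\<not> graph_connected V (E - C)" using cut(2) one[of "E - C"] by auto
  then obtain u v where uv: "u \<in> V" "v \<in> V" "(u, v) \<notin> (adjacency (E - C))\<^sup>*"
    using assms(1) by (auto simp: graph_connected_def)
  define A where "A = {w \<in> V. (u, w) \<in> (adjacency (E - C))\<^sup>*}"
  define D where "D = {e \<in> E. \<exists>a\<in>A. \<exists>b\<in>V - A. e = {a, b}}"
  have "D \<subseteq> C"
  proof
    fix e assume "e \<in> D"
    then obtain a b where e: "e \<in> E" "a \<in> A" "b \<in> V - A" "e = {a, b}" by (auto simp: D_def)
    show "e \<in> C"
    proof (rule ccontr)
      assume "e \<notin> C"
      then have "(a, b) \<in> adjacency (E - C)" using e by (simp add: adjacency_def)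
      then have "b \<in> A" using e by (auto simp: A_def intro: rtrancl_into_rtrancl)
      then show False using e by blast
    qed
  qed
  have "w \<in> A" if "(u, w) \<in> (adjacency (E - D))\<^sup>*" for w
    using that
  proof (induction rule: rtrancl_induct)
    case base
    then show ?case using uv by (simp add: A_def)
  next
    case (step w w')
    then have "{w, w'} \<in> E" "{w, w'} \<notin> D" by (auto simp: adjacency_def)
    then show ?case using step.IH edge_in_V unfolding D_def by blast
  qed
  then have "(u, v) \<notin> (adjacency (E - D))\<^sup>*" using uv by (auto simp: A_def)
  then have "edge_cut V E D"
    using two[OF uv(1,2)] one[OF assms(1)] by (auto simp: edge_cut_def D_def)
  then have "D = C" using \<open>D \<subseteq> C\<close> assms(2) by (auto simp: minimal_edge_cut_def)
  moreover have "A \<subseteq> V" by (auto simp: A_def)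
  ultimately show thesis using that by (simp add: D_def)
qed

lemma card_coboundary:
  assumes "A \<subseteq> V"
  shows "card {e \<in> E. \<exists>a\<in>A. \<exists>b\<in>V - A. e = {a, b}} = between (adj E) A (V - A)"
proof -
  have "{e \<in> E. \<exists>a\<in>A. \<exists>b\<in>V - A. e = {a, b}}
      = (\<lambda>(a, b). {a, b}) ` {(a, b) \<in> A \<times> (V - A). {a, b} \<in> E}" by auto
  moreover have "inj_on (\<lambda>(a, b). {a, b}) {(a, b) \<in> A \<times> (V - A). {a, b} \<in> E}"
    by (auto simp: inj_on_def doubleton_eq_iff)
  ultimately show ?thesis
    using between_adj[of A "V - A" E] assms finite_verts finite_subset[OF assms]
    by (simp add: card_image)
qed

lemma perfect_matching_of_pairing:
  assumes "pairing V (\<lambda>a b. {a, b} \<in> E) f"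
  shows "perfect_matching V E {{a, f a} |a. a \<in> V}"
proof -
  have "{e \<in> {{a, f a} |a. a \<in> V}. v \<in> e} = {{v, f v}}" if "v \<in> V" for v
    using assms that unfolding pairing_def by (auto simp: insert_commute)
  then show ?thesis
    using assms by (auto simp: perfect_matching_def regular_graph_def vertex_degree_def pairing_def)
qed

end

theorem corollary3p2:
  fixes V :: "'a set" and E :: "'a set set" and t :: nat
  assumes "fin_simple_graph V E"
    and "graph_connected V E"
    and "cubic_graph V E"
    and "bridgeless_graph V E"
    and "t \<ge> 1"
  shows "\<exists>M :: nat \<Rightarrow> 'a set set.
           (\<forall>i\<in>{1..t}. perfect_matching V E (M i)) \<and>
           \<not> (\<exists>C. k_edge_cut (2 * t + 1) V E C \<and> C \<subseteq> (\<Inter>i\<in>{1..t}. M i))"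
proof -
  interpret fin_simple_graph V E by fact
  have ne: "V \<noteq> {}" using assms(2) by (simp add: graph_connected_def)
  have y: "r_graph V (adj E) 3" using r_graph_adj assms by blast
  then interpret y: r_graph V "adj E" 3 .
  obtain f x where f: "\<And>i. i \<in> {1..t} \<Longrightarrow> pairing V (\<lambda>a b. 0 < adj E a b) (f i)"
    and x: "r_graph V x (2 * t + 3)"
    and xy: "\<And>a b. a \<in> V \<Longrightarrow> b \<in> V \<Longrightarrow>
      x a b + (\<Sum>i\<in>{1..t}. mate (f i) a b) = (t + 1) * adj E a b"
    using r_graph_matching_sequence[OF y ne, of t] by blast
  interpret x: r_graph V x "2 * t + 3" by (rule x)
  define M where "M i = {{a, f i a} |a. a \<in> V}" for i
  have fE: "pairing V (\<lambda>a b. {a, b} \<in> E) (f i)" if "i \<in> {1..t}" for i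
    using f[OF that] by (rule pairing_mono) (simp add: adj_def split: if_splits)
  have "perfect_matching V E (M i)" if "i \<in> {1..t}" for i
    unfolding M_def using fE[OF that] by (rule perfect_matching_of_pairing)
  moreover have False if C: "k_edge_cut (2 * t + 1) V E C" "C \<subseteq> (\<Inter>i\<in>{1..t}. M i)" for C
  proof -
    obtain A where A: "A \<subseteq> V" "C = {e \<in> E. \<exists>a\<in>A. \<exists>b\<in>V - A. e = {a, b}}"
      using minimal_cut_is_coboundary[OF assms(2), of C] C(1) unfolding k_edge_cut_def by blast
    have size: "between (adj E) A (V - A) = 2 * t + 1"
      using card_coboundary[OF A(1)] A(2) C(1) by (simp add: k_edge_cut_def)
    then have "odd (card A)" using y.parity[OF A(1)] by auto
    then have "2 * t + 3 \<le> between x A (V - A)" using x.odd_cut A(1) by blast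
    \<comment> \<open>On a cut contained in all \<open>t\<close> matchings, \<open>t\<close> of the \<open>t + 1\<close> copies of each edge have been used up.\<close>
    also have "between x A (V - A) = between (adj E) A (V - A)"
    proof (rule between_cong)
      fix a b assume ab: "a \<in> A" "b \<in> V - A"
      have "mate (f i) a b = adj E a b" if i: "i \<in> {1..t}" for i
      proof (cases "{a, b} \<in> E")
        case True
        then have "{a, b} \<in> M i" using A(2) C(2) ab i by blast
        then obtain c where "c \<in> V" "{a, b} = {c, f i c}" by (auto simp: M_def)
        then have "f i a = b" using fE[OF i] by (auto simp: doubleton_eq_iff pairing_def)
        then show ?thesis using True by (simp add: mate_def adj_def)
      next
        case False
        then have "f i a \<noteq> b" using fE[OF i] ab A(1) by (auto simp: pairing_def)
        then show ?thesis using False by (simp add: mate_def adj_def)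
      qed
      then have "(\<Sum>i\<in>{1..t}. mate (f i) a b) = t * adj E a b" by simp
      then show "x a b = adj E a b" using xy[of a b] ab A(1) by auto
    qed
    finally show False using size by simp
  qed
  ultimately show ?thesis by (intro exI[of _ M]) blast
qed

end
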